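(* Let $0<p,q\le1$, let $\mathcal{X}$ be a $p$-sequence functor and let $\mathcal{Y}$ be a $q$-sequence functor such that $\mathcal{Y}$ is scalarly dominated by $\mathcal{X}$. Then the class $\mathcal{P}(\mathcal{X};\mathcal{Y})$ of $(\mathcal{X};\mathcal{Y})$-summing homogeneous polynomials, endowed with $\|\cdot\|_{\mathcal{P}(\mathcal{X};\mathcal{Y})}$, is a $q$-Banach polynomial hyper-ideal.
   Context: All Banach spaces are over $\mathbb{K}=\mathbb{R}$ or $\mathbb{C}$. $\mathcal{P}(^nE;F)$ ($n\ge 1$) is the Banach space of continuous $n$-homogeneous polynomials from $E$ to $F$ with the sup norm $\|\cdot\|$; $\mathcal{P}(^nE)=\mathcal{P}(^nE;\mathbb{K})$, $\mathcal{L}(E;F)=\mathcal{P}(^1E;F)$, $B_X$ is the closed unit ball of $X$. A $p$-sequence functor is a correspondence $\mathcal{X}$ associating to each Banach space $E$ a $p$-Banach space $(\mathcal{X}(E),\|\cdot\|_{\mathcal{X}(E)})$ such that: (i) $\mathcal{X}(E)$ is a linear subspace of $E^{\mathbb{N}}$ with the usual operations; (ii) for $x\in E$ and $j\in\mathbb{N}$, the sequence with $x$ at the $j$-th coordinate and $0$ elsewhere belongs to $\mathcal{X}(E)$ and has $\mathcal{X}(E)$-norm $\|x\|_E$; (iii) for $u\in\mathcal{L}(E;F)$ and every finite sequence $(x_j)_{j=1}^k:=(x_1,\dots,x_k,0,0,\dots)$ in $E$, $\|(u(x_j))_{j=1}^k\|_{\mathcal{X}(F)}\le\|u\|\,\|(x_j)_{j=1}^k\|_{\mathcal{X}(E)}$.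 $\mathcal{Y}$ is scalarly dominated by $\mathcal{X}$ if $\|(\lambda_j)_{j=1}^k\|_{\mathcal{Y}(\mathbb{K})}\le\|(\lambda_j)_{j=1}^k\|_{\mathcal{X}(\mathbb{K})}$ for every finite sequence of scalars. $P\in\mathcal{P}(^nE;F)$ is $(\mathcal{X};\mathcal{Y})$-summing, written $P\in\mathcal{P}(\mathcal{X};\mathcal{Y})(^nE;F)$, if there is $C>0$ with $\|(P(x_j))_{j=1}^k\|_{\mathcal{Y}(F)}\le C\sup_{R\in B_{\mathcal{P}(^nE)}}\|(R(x_j))_{j=1}^k\|_{\mathcal{X}(\mathbb{K})}$ for all finite sequences $(x_j)_{j=1}^k$ in $E$; $\|P\|_{\mathcal{P}(\mathcal{X};\mathcal{Y})}$ is the infimum of such $C$. For $0<q\le1$, a $q$-Banach polynomial hyper-ideal is a class $\mathcal{Q}$ of continuous homogeneous polynomials between Banach spaces with a function $\|\cdot\|_{\mathcal Q}\colon\mathcal{Q}\to[0,\infty)$ such that, with $\mathcal{Q}(^nE;F)=\mathcal{P}(^nE;F)\cap\mathcal{Q}$: (i) each $\mathcal{Q}(^nE;F)$ is a linear subspace of $\mathcal{P}(^nE;F)$ containing all finite sums of polynomials $x\mapsto\varphi(x)^ny$ with $\varphi\in E'$, $y\in F$; (ii) $\|\cdot\|_{\mathcal Q}$ is a complete $q$-norm on each $\mathcal{Q}(^nE;F)$; (iii) $\|\widehat{I_n}\|_{\mathcal Q}=1$ for all $n$, where $\widehat{I_n}\colon\mathbb{K}\to\mathbb{K}$, $\widehat{I_n}(\lambda)=\lambda^n$;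 (iv) for all $n,m$ and Banach spaces $E,F,G,H$, if $P\in\mathcal{Q}(^nE;F)$, $Q\in\mathcal{P}(^mG;E)$, $t\in\mathcal{L}(F;H)$, then $t\circ P\circ Q\in\mathcal{Q}(^{mn}G;H)$ and $\|t\circ P\circ Q\|_{\mathcal Q}\le\|t\|\,\|P\|_{\mathcal Q}\|Q\|^n$. *)

theory Defs
  imports Complex_Main "HOL-Algebra.Module"
begin

text \<open>
  The scalar field is a type of class \<open>{real_normed_field, banach}\<close>.  By the
  Gelfand--Mazur theorem such a field is isometrically isomorphic to the reals or to the
  complex numbers (and both are instances).

  Since a sequence functor and a polynomial ideal range over all Banach spaces at once,
  Banach spaces are carrier-based: modules of HOL-Algebra with a norm, all carriers being
  subsets of one universe type.  The universe is a sum type \<open>'k + 'u\<close> with \<open>'u\<close>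
  arbitrary, so that the scalar field itself lives in it as the range of \<open>Inl\<close>.
  The ring fields \<open>mult\<close> and \<open>one\<close> of a module record play no role.
\<close>

definition scalar_ring :: "'k::field ring" where
  "scalar_ring = \<lparr>carrier = UNIV, monoid.mult = (*), one = 1, zero = 0, add = (+)\<rparr>"

record ('k, 'v) nspace = "('k, 'v) module" +
  vnorm :: "'v \<Rightarrow> real"


section \<open>\<open>p\<close>-Banach spaces\<close>

definition p_norm_on ::
  "real \<Rightarrow> ('k::real_normed_field, 'v, 'm) module_scheme \<Rightarrow> ('v \<Rightarrow> real) \<Rightarrow> bool" where
  "p_norm_on p V N \<longleftrightarrow>
     (\<forall>x\<in>carrier V. 0 \<le> N x) \<and>
     (\<forall>x\<in>carrier V. N x = 0 \<longleftrightarrow> x = \<zero>\<^bsub>V\<^esub>) \<and>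
     (\<forall>a. \<forall>x\<in>carrier V. N (a \<odot>\<^bsub>V\<^esub> x) = norm a * N x) \<and>
     (\<forall>x\<in>carrier V. \<forall>y\<in>carrier V. N (x \<oplus>\<^bsub>V\<^esub> y) powr p \<le> N x powr p + N y powr p)"

definition complete_on ::
  "('k, 'v, 'm) module_scheme \<Rightarrow> ('v \<Rightarrow> real) \<Rightarrow> bool" where
  "complete_on V N \<longleftrightarrow>
     (\<forall>s. (\<forall>i::nat. s i \<in> carrier V) \<and>
          (\<forall>e>0. \<exists>M. \<forall>i\<ge>M. \<forall>j\<ge>M. N (s i \<ominus>\<^bsub>V\<^esub> s j) < e) \<longrightarrow>
          (\<exists>l\<in>carrier V. (\<lambda>i. N (s i \<ominus>\<^bsub>V\<^esub> l)) \<longlonglongrightarrow> 0))"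

definition p_banach ::
  "real \<Rightarrow> ('k::real_normed_field, 'v, 'm) module_scheme \<Rightarrow> ('v \<Rightarrow> real) \<Rightarrow> bool" where
  "p_banach p V N \<longleftrightarrow> module scalar_ring V \<and> p_norm_on p V N \<and> complete_on V N"

text \<open>A 1-norm is an ordinary norm, since \<open>x powr 1 = x\<close> for \<open>x \<ge> 0\<close>.\<close>

definition banach_space :: "('k::real_normed_field, 'v) nspace \<Rightarrow> bool" where
  "banach_space E \<longleftrightarrow> p_banach 1 E (vnorm E)"

definition scalar_space :: "('k::real_normed_field, 'k + 'u) nspace" where
  "scalar_space =
     \<lparr>carrier = range Inl,
      monoid.mult = (\<lambda>x y. Inl (projl x * projl y)), one = Inl 1,
      zero = Inl 0, add = (\<lambda>x y. Inl (projl x + projl y)),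
      smult = (\<lambda>a x. Inl (a * projl x)),
      vnorm = (\<lambda>x. norm (projl x))\<rparr>"


section \<open>Continuous homogeneous polynomials\<close>

definition multilinear_map ::
  "nat \<Rightarrow> ('k, 'v) nspace \<Rightarrow> ('k, 'w) nspace \<Rightarrow> ((nat \<Rightarrow> 'v) \<Rightarrow> 'w) \<Rightarrow> bool" where
  "multilinear_map n E F A \<longleftrightarrow>
     (\<forall>x \<in> {..<n} \<rightarrow>\<^sub>E carrier E. A x \<in> carrier F) \<and>
     (\<forall>x \<in> {..<n} \<rightarrow>\<^sub>E carrier E. \<forall>i<n. \<forall>y\<in>carrier E. \<forall>z\<in>carrier E.
        A (x(i := y \<oplus>\<^bsub>E\<^esub> z)) = A (x(i := y)) \<oplus>\<^bsub>F\<^esub> A (x(i := z))) \<and>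
     (\<forall>x \<in> {..<n} \<rightarrow>\<^sub>E carrier E. \<forall>i<n. \<forall>a. \<forall>y\<in>carrier E.
        A (x(i := a \<odot>\<^bsub>E\<^esub> y)) = a \<odot>\<^bsub>F\<^esub> A (x(i := y)))"

definition continuous_map_on ::
  "('k, 'v) nspace \<Rightarrow> ('k, 'w) nspace \<Rightarrow> ('v \<Rightarrow> 'w) \<Rightarrow> bool" where
  "continuous_map_on E F f \<longleftrightarrow>
     (\<forall>x\<in>carrier E. \<forall>e>0. \<exists>d>0. \<forall>y\<in>carrier E.
        vnorm E (y \<ominus>\<^bsub>E\<^esub> x) < d \<longrightarrow> vnorm F (f y \<ominus>\<^bsub>F\<^esub> f x) < e)"

text \<open>
  Polynomials are extensional functions (undefined off the carrier), so that equality of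
  polynomials is equality of HOL functions.  \<open>cpoly 1 E F\<close> is the space of continuous
  linear operators.
\<close>

definition cpoly ::
  "nat \<Rightarrow> ('k, 'v) nspace \<Rightarrow> ('k, 'w) nspace \<Rightarrow> ('v \<Rightarrow> 'w) set" where
  "cpoly n E F =
     {P \<in> carrier E \<rightarrow>\<^sub>E carrier F.
        (\<exists>A. multilinear_map n E F A \<and>
             (\<forall>x\<in>carrier E. P x = A (\<lambda>i\<in>{..<n}. x))) \<and>
        continuous_map_on E F P}"

definition cpoly_module ::
  "nat \<Rightarrow> ('k, 'v) nspace \<Rightarrow> ('k, 'w) nspace \<Rightarrow> ('k, 'v \<Rightarrow> 'w) module" where
  "cpoly_module n E F =
     \<lparr>carrier = cpoly n E F, monoid.mult = undefined, one = undefined,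
      zero = (\<lambda>x\<in>carrier E. \<zero>\<^bsub>F\<^esub>),
      add = (\<lambda>P Q. \<lambda>x\<in>carrier E. P x \<oplus>\<^bsub>F\<^esub> Q x),
      smult = (\<lambda>a P. \<lambda>x\<in>carrier E. a \<odot>\<^bsub>F\<^esub> P x)\<rparr>"

text \<open>Continuous polynomials are bounded on the unit ball, so the supremum is a proper one.\<close>

definition poly_norm ::
  "('k, 'v) nspace \<Rightarrow> ('k, 'w) nspace \<Rightarrow> ('v \<Rightarrow> 'w) \<Rightarrow> real" where
  "poly_norm E F P = (SUP x \<in> {x \<in> carrier E. vnorm E x \<le> 1}. vnorm F (P x))"


section \<open>Sequence functors\<close>

text \<open>
  \<open>(x\<^sub>0, \<dots>, x\<^sub>k\<^sub>-\<^sub>1, 0, 0, \<dots>)\<close>; coordinates are numbered from 0.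
\<close>

definition fin_seq :: "('k, 'v) nspace \<Rightarrow> nat \<Rightarrow> (nat \<Rightarrow> 'v) \<Rightarrow> nat \<Rightarrow> 'v" where
  "fin_seq E k x = (\<lambda>j. if j < k then x j else \<zero>\<^bsub>E\<^esub>)"

definition single_seq :: "('k, 'v) nspace \<Rightarrow> nat \<Rightarrow> 'v \<Rightarrow> nat \<Rightarrow> 'v" where
  "single_seq E j x = (\<lambda>i. if i = j then x else \<zero>\<^bsub>E\<^esub>)"

definition seq_module :: "('k, 'v) nspace \<Rightarrow> ('k, nat \<Rightarrow> 'v) module" where
  "seq_module E =
     \<lparr>carrier = UNIV \<rightarrow> carrier E, monoid.mult = undefined, one = undefined,
      zero = (\<lambda>_. \<zero>\<^bsub>E\<^esub>),
      add = (\<lambda>x y j. x j \<oplus>\<^bsub>E\<^esub> y j),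
      smult = (\<lambda>a x j. a \<odot>\<^bsub>E\<^esub> x j)\<rparr>"

text \<open>To each space: a set of sequences together with a norm on it.\<close>

type_synonym ('k, 'u) seq_corr =
  "('k, 'k + 'u) nspace \<Rightarrow> (nat \<Rightarrow> 'k + 'u) set \<times> ((nat \<Rightarrow> 'k + 'u) \<Rightarrow> real)"

definition seq_functor :: "real \<Rightarrow> ('k::real_normed_field, 'u) seq_corr \<Rightarrow> bool" where
  "seq_functor p X \<longleftrightarrow>
     (\<forall>E. banach_space E \<longrightarrow>
        submodule (fst (X E)) scalar_ring (seq_module E) \<and>
        p_banach p ((seq_module E)\<lparr>carrier := fst (X E)\<rparr>) (snd (X E)) \<and>
        (\<forall>x\<in>carrier E. \<forall>j.
           single_seq E j x \<in> fst (X E) \<and> snd (X E) (single_seq E j x) = vnorm E x)) \<and>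
     (\<forall>E F. banach_space E \<longrightarrow> banach_space F \<longrightarrow>
        (\<forall>u \<in> cpoly 1 E F. \<forall>k. \<forall>x \<in> {..<k} \<rightarrow> carrier E.
           snd (X F) (fin_seq F k (\<lambda>j. u (x j)))
             \<le> poly_norm E F u * snd (X E) (fin_seq E k x)))"

definition scalarly_dominated ::
  "('k::real_normed_field, 'u) seq_corr \<Rightarrow> ('k, 'u) seq_corr \<Rightarrow> bool" where
  "scalarly_dominated Y X \<longleftrightarrow>
     (\<forall>k. \<forall>x \<in> {..<k} \<rightarrow> carrier scalar_space.
        snd (Y scalar_space) (fin_seq scalar_space k x)
          \<le> snd (X scalar_space) (fin_seq scalar_space k x))"


section \<open>Summing polynomials and hyper-ideals\<close>

text \<open>
  For a sequence functor \<open>X\<close> the set under this supremum is bounded, because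
  every \<open>|R(x\<^sub>j)|\<close> is at most the \<open>n\<close>-th power of the norm of \<open>x\<^sub>j\<close>.
\<close>

definition weak_poly_norm ::
  "('k::real_normed_field, 'u) seq_corr \<Rightarrow> nat \<Rightarrow> ('k, 'k + 'u) nspace \<Rightarrow> nat
     \<Rightarrow> (nat \<Rightarrow> 'k + 'u) \<Rightarrow> real" where
  "weak_poly_norm X n E k x =
     (SUP R \<in> {R \<in> cpoly n E scalar_space. poly_norm E scalar_space R \<le> 1}.
        snd (X scalar_space) (fin_seq scalar_space k (\<lambda>j. R (x j))))"

definition summing_const ::
  "('k::real_normed_field, 'u) seq_corr \<Rightarrow> ('k, 'u) seq_corr \<Rightarrow> nat
     \<Rightarrow> ('k, 'k + 'u) nspace \<Rightarrow> ('k, 'k + 'u) nspace \<Rightarrow> ('k + 'u \<Rightarrow> 'k + 'u) \<Rightarrow> real \<Rightarrow> bool"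
  where
  "summing_const X Y n E F P C \<longleftrightarrow>
     0 < C \<and>
     (\<forall>k. \<forall>x \<in> {..<k} \<rightarrow> carrier E.
        snd (Y F) (fin_seq F k (\<lambda>j. P (x j))) \<le> C * weak_poly_norm X n E k x)"

text \<open>
  A class of homogeneous polynomials is given by its components, with the norm on each:
  degree, domain and codomain are part of a polynomial.
\<close>

type_synonym ('k, 'u) poly_class =
  "nat \<Rightarrow> ('k, 'k + 'u) nspace \<Rightarrow> ('k, 'k + 'u) nspace
     \<Rightarrow> ('k + 'u \<Rightarrow> 'k + 'u) set \<times> (('k + 'u \<Rightarrow> 'k + 'u) \<Rightarrow> real)"

definition summing_polys ::
  "('k::real_normed_field, 'u) seq_corr \<Rightarrow> ('k, 'u) seq_corr \<Rightarrow> ('k, 'u) poly_class" where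
  "summing_polys X Y = (\<lambda>n E F.
     ({P \<in> cpoly n E F. \<exists>C. summing_const X Y n E F P C},
      (\<lambda>P. Inf {C. summing_const X Y n E F P C})))"

definition banach_hyper_ideal ::
  "real \<Rightarrow> ('k::real_normed_field, 'u) poly_class \<Rightarrow> bool" where
  "banach_hyper_ideal q \<Q> \<longleftrightarrow>
     (\<forall>n\<ge>1. \<forall>E F. banach_space E \<longrightarrow> banach_space F \<longrightarrow>
        submodule (fst (\<Q> n E F)) scalar_ring (cpoly_module n E F) \<and>
        (\<forall>(k::nat) (\<phi> :: nat \<Rightarrow> 'k + 'u \<Rightarrow> 'k + 'u) y.
           (\<forall>i<k. \<phi> i \<in> cpoly 1 E scalar_space \<and> y i \<in> carrier F) \<longrightarrow>
           (\<lambda>x\<in>carrier E. \<Oplus>\<^bsub>F\<^esub>i\<in>{..<k}. (projl (\<phi> i x)) ^ n \<odot>\<^bsub>F\<^esub> y i) \<in> fst (\<Q> n E F)) \<and>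
        p_banach q ((cpoly_module n E F)\<lparr>carrier := fst (\<Q> n E F)\<rparr>) (snd (\<Q> n E F))) \<and>
     (\<forall>n\<ge>1. snd (\<Q> n scalar_space scalar_space)
               (\<lambda>x\<in>carrier scalar_space. Inl (projl x ^ n)) = 1) \<and>
     (\<forall>n\<ge>1. \<forall>m\<ge>1. \<forall>E F G H.
        banach_space E \<longrightarrow> banach_space F \<longrightarrow> banach_space G \<longrightarrow> banach_space H \<longrightarrow>
        (\<forall>P \<in> fst (\<Q> n E F). \<forall>R \<in> cpoly m G E. \<forall>t \<in> cpoly 1 F H.
           (\<lambda>x\<in>carrier G. t (P (R x))) \<in> fst (\<Q> (m * n) G H) \<and>
           snd (\<Q> (m * n) G H) (\<lambda>x\<in>carrier G. t (P (R x)))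
             \<le> poly_norm F H t * snd (\<Q> n E F) P * poly_norm G E R ^ n))"

end

theory Submission
  imports Defs
begin

text \<open>
  All properties of the summing norm come from the defining inequality
  \<open>\<parallel>(P x\<^sub>j)\<parallel> \<le> C w\<close>, where the norm is that of \<open>Y F\<close> and the weak norm \<open>w\<close> is the supremum of
  the norms of \<open>(R x\<^sub>j)\<close> in \<open>X K\<close> over the unit ball of scalar polynomials \<open>R\<close> of the same
  degree. The infimum of the admissible \<open>C\<close> is admissible (\<open>summing_bound_norm\<close>), and the
  \<open>q\<close>-norm properties of \<open>Y F\<close> pass to it. Sequences of length one show that it dominates the
  sup norm (\<open>summing_bound_pointwise\<close>), so it vanishes only at \<open>0\<close>.

  The ideal inequality holds since the weak norm of \<open>(R x\<^sub>j)\<close> is at most \<open>\<parallel>R\<parallel>\<^sup>n\<close> times the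
  weak norm of \<open>(x\<^sub>j)\<close> for degree \<open>m n\<close>: composing a scalar polynomial with \<open>R\<close> gives a scalar
  polynomial again (\<open>weak_norm_compose\<close>). The functor \<open>Y\<close> takes care of linear operators on the
  left. Scalar domination enters for polynomials with values in a line: there it compares \<open>Y K\<close>
  with \<open>X K\<close>, which gives the polynomials of finite type and the value \<open>1\<close> for the power maps.

  Completeness needs most of the work. A Cauchy sequence converges pointwise, and on
  sequences of a fixed finite length the norm of \<open>Y F\<close> respects coordinatewise limits
  (\<open>fin_seq_norm_limit\<close>), so the defining inequalities survive (\<open>summing_complete\<close>). What has to
  be shown is that the limit is a polynomial, that is, the diagonal of a multilinear map. The
  multilinear maps that represent the members of the sequence need not converge, but their
  symmetrizations do: by the polarization formula these are fixed combinations of values on the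
  diagonal. Only the existence of such a formula matters, and it is obtained by splitting off
  one index at a time (\<open>hitting_part_insert\<close>, \<open>multilinear_diagonal_limit\<close>).
\<close>

section \<open>Linear spaces over the scalar field\<close>

lemma scalar_ring_simps [simp]:
  "carrier scalar_ring = UNIV" "\<one>\<^bsub>scalar_ring\<^esub> = 1" "\<zero>\<^bsub>scalar_ring\<^esub> = 0"
  "a \<otimes>\<^bsub>scalar_ring\<^esub> b = a * b" "a \<oplus>\<^bsub>scalar_ring\<^esub> b = a + b"
  by (simp_all add: scalar_ring_def)

lemma cring_scalar_ring: "cring (scalar_ring :: 'k::field ring)"
proof (rule cringI)
  show "abelian_group (scalar_ring :: 'k ring)"
  proof (rule abelian_groupI)
    fix x :: 'k
    show "\<exists>y\<in>carrier scalar_ring. y \<oplus>\<^bsub>scalar_ring\<^esub> x = \<zero>\<^bsub>scalar_ring\<^esub>"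
      by (rule bexI[of _ "- x"]) simp_all
  qed (simp_all add: add_ac)
  show "Group.comm_monoid (scalar_ring :: 'k ring)"
    by (rule comm_monoidI) (simp_all add: mult_ac)
qed (simp_all add: ring_distribs)

locale linear_space =
  fixes V :: "('k::real_normed_field, 'v, 'm) module_scheme" (structure)
  assumes module_V: "module scalar_ring V"
begin

sublocale abelian_group V
  using module_V by (rule module.axioms)

lemma smult_closed [simp, intro]: "x \<in> carrier V \<Longrightarrow> a \<odot> x \<in> carrier V"
  using module.smult_closed[OF module_V] by simp

lemma smult_add_left: "x \<in> carrier V \<Longrightarrow> (a + b) \<odot> x = a \<odot> x \<oplus> b \<odot> x"
  using module.smult_l_distr[OF module_V] by simp

lemma smult_add_right:
  "x \<in> carrier V \<Longrightarrow> y \<in> carrier V \<Longrightarrow> a \<odot> (x \<oplus> y) = a \<odot> x \<oplus> a \<odot> y"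
  using module.smult_r_distr[OF module_V] by simp

lemma smult_assoc: "x \<in> carrier V \<Longrightarrow> a \<odot> (b \<odot> x) = (a * b) \<odot> x"
  using module.smult_assoc1[OF module_V] by simp

lemma smult_one [simp]: "x \<in> carrier V \<Longrightarrow> 1 \<odot> x = x"
  using module.smult_one[OF module_V] by simp

lemma smult_zero_left [simp]: "x \<in> carrier V \<Longrightarrow> 0 \<odot> x = \<zero>"
  using module.smult_l_null[OF module_V] by simp

lemma smult_zero_right [simp]: "a \<odot> \<zero> = \<zero>"
  using module.smult_r_null[OF module_V] by simp

lemma minus_conv_smult: "x \<in> carrier V \<Longrightarrow> \<ominus> x = (- 1) \<odot> x"
proof (rule minus_equality)
  assume x: "x \<in> carrier V"
  have "(- 1) \<odot> x \<oplus> x = (- 1 + 1) \<odot> x"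
    using x by (simp only: smult_add_left smult_one)
  then show "(- 1) \<odot> x \<oplus> x = \<zero>"
    using x by simp
qed auto

text \<open>The additive inverse of a record is defined by a description over its carrier. Written as
  multiplication by \<open>-1\<close> it no longer mentions the carrier, so that differences in a subspace
  are computed as in the surrounding space.\<close>

lemma diff_conv_smult: "y \<in> carrier V \<Longrightarrow> x \<ominus> y = x \<oplus> (- 1) \<odot> y"
  by (simp add: a_minus_def minus_conv_smult)

lemma diff_zero [simp]: "x \<in> carrier V \<Longrightarrow> x \<ominus> \<zero> = x"
  by (simp add: diff_conv_smult)

lemma diff_self [simp]: "x \<in> carrier V \<Longrightarrow> x \<ominus> x = \<zero>"
  by (simp add: a_minus_def r_neg)

lemma smult_diff:
  "x \<in> carrier V \<Longrightarrow> y \<in> carrier V \<Longrightarrow> a \<odot> (x \<ominus> y) = a \<odot> x \<ominus> a \<odot> y"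
  by (simp add: diff_conv_smult smult_add_right smult_assoc)

lemma diff_smult: "x \<in> carrier V \<Longrightarrow> (a - b) \<odot> x = a \<odot> x \<ominus> b \<odot> x"
  using smult_add_left[of x a "- b"] by (simp add: diff_conv_smult smult_assoc)

lemma add_diff_add:
  "\<lbrakk>x \<in> carrier V; y \<in> carrier V; z \<in> carrier V; w \<in> carrier V\<rbrakk>
    \<Longrightarrow> (x \<oplus> y) \<ominus> (z \<oplus> w) = (x \<ominus> z) \<oplus> (y \<ominus> w)"
  by (simp add: diff_conv_smult smult_add_right a_ac)

lemma diff_swap: "x \<in> carrier V \<Longrightarrow> y \<in> carrier V \<Longrightarrow> y \<ominus> x = (- 1) \<odot> (x \<ominus> y)"
  by (simp add: diff_conv_smult smult_add_right smult_assoc a_ac)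

lemma diff_add_diff:
  "\<lbrakk>x \<in> carrier V; y \<in> carrier V; z \<in> carrier V\<rbrakk> \<Longrightarrow> (x \<ominus> y) \<oplus> (y \<ominus> z) = x \<ominus> z"
  by (simp add: a_minus_def a_assoc r_neg1)

lemma add_diff_cancel:
  "\<lbrakk>x \<in> carrier V; y \<in> carrier V\<rbrakk> \<Longrightarrow> (x \<oplus> y) \<ominus> x = y"
  by (simp add: a_minus_def a_comm[of x y] a_assoc r_neg)

lemma finsum_const_smult:
  assumes "finite A" "v \<in> carrier V"
  shows "(\<Oplus>i\<in>A. v) = of_nat (card A) \<odot> v"
  using assms(1)
proof induction
  case (insert a A)
  then show ?case
    using assms(2) by (simp add: smult_add_left)
qed (use assms(2) in simp)

end

lemma linear_spaceI:
  fixes V :: "('k::real_normed_field, 'v, 'm) module_scheme" (structure)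
  assumes "\<zero> \<in> carrier V"
    and "\<And>x y. x \<in> carrier V \<Longrightarrow> y \<in> carrier V \<Longrightarrow> x \<oplus> y \<in> carrier V"
    and "\<And>a x. x \<in> carrier V \<Longrightarrow> a \<odot> x \<in> carrier V"
    and "\<And>x y. x \<in> carrier V \<Longrightarrow> y \<in> carrier V \<Longrightarrow> x \<oplus> y = y \<oplus> x"
    and "\<And>x y z. x \<in> carrier V \<Longrightarrow> y \<in> carrier V \<Longrightarrow> z \<in> carrier V \<Longrightarrow>
        (x \<oplus> y) \<oplus> z = x \<oplus> (y \<oplus> z)"
    and "\<And>x. x \<in> carrier V \<Longrightarrow> \<zero> \<oplus> x = x"
    and "\<And>x. x \<in> carrier V \<Longrightarrow> (- 1) \<odot> x \<oplus> x = \<zero>"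
    and "\<And>a b x. x \<in> carrier V \<Longrightarrow> (a + b) \<odot> x = a \<odot> x \<oplus> b \<odot> x"
    and "\<And>a x y. x \<in> carrier V \<Longrightarrow> y \<in> carrier V \<Longrightarrow>
        a \<odot> (x \<oplus> y) = a \<odot> x \<oplus> a \<odot> y"
    and "\<And>a b x. x \<in> carrier V \<Longrightarrow> (a * b) \<odot> x = a \<odot> (b \<odot> x)"
    and "\<And>x. x \<in> carrier V \<Longrightarrow> 1 \<odot> x = x"
  shows "linear_space V"
proof (intro linear_space.intro moduleI cring_scalar_ring)
  show "abelian_group V"
    by (rule abelian_groupI) (use assms in blast)+
qed (use assms in auto)


section \<open>Normed spaces and limits\<close>

locale normed_space = linear_space E for E :: "('k::real_normed_field, 'v) nspace" (structure) +
  assumes banach: "banach_space E"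
begin

lemma norm_nonneg [simp]: "x \<in> carrier E \<Longrightarrow> 0 \<le> vnorm E x"
  using banach by (simp add: banach_space_def p_banach_def p_norm_on_def)

lemma norm_eq_zero [simp]: "x \<in> carrier E \<Longrightarrow> vnorm E x = 0 \<longleftrightarrow> x = \<zero>"
  using banach by (simp add: banach_space_def p_banach_def p_norm_on_def)

lemma norm_zero [simp]: "vnorm E \<zero> = 0"
  by simp

lemma norm_smult: "x \<in> carrier E \<Longrightarrow> vnorm E (a \<odot> x) = norm a * vnorm E x"
  using banach by (simp add: banach_space_def p_banach_def p_norm_on_def)

lemma norm_add_le:
  assumes "x \<in> carrier E" "y \<in> carrier E"
  shows "vnorm E (x \<oplus> y) \<le> vnorm E x + vnorm E y"
proof -
  have "vnorm E (x \<oplus> y) powr 1 \<le> vnorm E x powr 1 + vnorm E y powr 1"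
    using banach assms by (simp add: banach_space_def p_banach_def p_norm_on_def del: powr_one')
  then show ?thesis
    using assms by simp
qed

lemma norm_diff_commute:
  "x \<in> carrier E \<Longrightarrow> y \<in> carrier E \<Longrightarrow> vnorm E (x \<ominus> y) = vnorm E (y \<ominus> x)"
  by (simp add: diff_swap[of y x] norm_smult)

lemma norm_diff_triangle:
  "\<lbrakk>x \<in> carrier E; y \<in> carrier E; z \<in> carrier E\<rbrakk>
    \<Longrightarrow> vnorm E (x \<ominus> z) \<le> vnorm E (x \<ominus> y) + vnorm E (y \<ominus> z)"
  using norm_add_le[of "x \<ominus> y" "y \<ominus> z"] by (simp add: diff_add_diff)

lemma norm_le_norm_diff:
  "\<lbrakk>x \<in> carrier E; y \<in> carrier E\<rbrakk> \<Longrightarrow> vnorm E x \<le> vnorm E (x \<ominus> y) + vnorm E y"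
  using norm_diff_triangle[of x y \<zero>] by simp

definition tends_to :: "(nat \<Rightarrow> 'v) \<Rightarrow> 'v \<Rightarrow> bool" where
  "tends_to s l \<longleftrightarrow> (\<forall>i. s i \<in> carrier E) \<and> l \<in> carrier E \<and> (\<lambda>i. vnorm E (s i \<ominus> l)) \<longlonglongrightarrow> 0"

lemma tends_to_add:
  assumes "tends_to s l" "tends_to t m"
  shows "tends_to (\<lambda>i. s i \<oplus> t i) (l \<oplus> m)"
proof -
  have "(\<lambda>i. vnorm E (s i \<ominus> l) + vnorm E (t i \<ominus> m)) \<longlonglongrightarrow> 0 + 0"
    using assms by (intro tendsto_add) (simp_all add: tends_to_def)
  moreover have "vnorm E ((s i \<oplus> t i) \<ominus> (l \<oplus> m)) \<le> vnorm E (s i \<ominus> l) + vnorm E (t i \<ominus> m)" for i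
    using assms by (simp add: tends_to_def add_diff_add norm_add_le)
  moreover have "0 \<le> vnorm E ((s i \<oplus> t i) \<ominus> (l \<oplus> m))" for i
    using assms by (simp add: tends_to_def)
  ultimately have "(\<lambda>i. vnorm E ((s i \<oplus> t i) \<ominus> (l \<oplus> m))) \<longlonglongrightarrow> 0"
    using tendsto_sandwich[of "\<lambda>_. 0" "\<lambda>i. vnorm E ((s i \<oplus> t i) \<ominus> (l \<oplus> m))" sequentially
        "\<lambda>i. vnorm E (s i \<ominus> l) + vnorm E (t i \<ominus> m)" 0]
    by simp
  then show ?thesis
    using assms by (simp add: tends_to_def)
qed

lemma tends_to_smult:
  assumes "tends_to s l"
  shows "tends_to (\<lambda>i. a \<odot> s i) (a \<odot> l)"
proof -
  have "(\<lambda>i. norm a * vnorm E (s i \<ominus> l)) \<longlonglongrightarrow> norm a * 0"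
    using assms by (intro tendsto_mult) (auto simp: tends_to_def)
  then show ?thesis
    using assms by (auto simp: tends_to_def norm_smult simp flip: smult_diff)
qed

lemma tends_to_diff:
  assumes "tends_to s l" "tends_to t m"
  shows "tends_to (\<lambda>i. s i \<ominus> t i) (l \<ominus> m)"
  using tends_to_add[OF assms(1) tends_to_smult[OF assms(2), of "- 1"]] assms
  by (simp add: diff_conv_smult tends_to_def)

lemma tends_to_unique:
  assumes "tends_to s l" "tends_to s m"
  shows "l = m"
proof -
  have "tends_to (\<lambda>i. s i \<ominus> s i) (l \<ominus> m)"
    using assms by (rule tends_to_diff)
  then have "(\<lambda>i. vnorm E (\<zero> \<ominus> (l \<ominus> m))) \<longlonglongrightarrow> 0"
    using assms by (simp add: tends_to_def)
  then have "vnorm E (\<zero> \<ominus> (l \<ominus> m)) = 0"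
    by (simp add: LIMSEQ_const_iff)
  then have "l \<ominus> m = \<zero>"
    using assms norm_diff_commute[of "\<zero>" "l \<ominus> m"] by (auto simp: tends_to_def)
  then show ?thesis
    using assms diff_add_diff[of l m \<zero>] by (simp add: tends_to_def)
qed

lemma Cauchy_tends_to:
  assumes "\<And>i. s i \<in> carrier E"
    and "\<And>e. 0 < e \<Longrightarrow> \<exists>M. \<forall>i\<ge>M. \<forall>j\<ge>M. vnorm E (s i \<ominus> s j) < e"
  shows "\<exists>l. tends_to s l"
proof -
  have "complete_on E (vnorm E)"
    using banach by (simp add: banach_space_def p_banach_def)
  then show ?thesis
    using assms unfolding complete_on_def tends_to_def by blast
qed

end

lemma normed_spaceI: "banach_space E \<Longrightarrow> normed_space E"
  unfolding normed_space_def linear_space_def normed_space_axioms_def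
  by (auto simp: banach_space_def p_banach_def)

section \<open>Multilinear maps and polarization\<close>

lemma multilinear_map_closed:
  "multilinear_map n E F A \<Longrightarrow> x \<in> {..<n} \<rightarrow>\<^sub>E carrier E \<Longrightarrow> A x \<in> carrier F"
  by (simp add: multilinear_map_def)

lemma multilinear_map_add:
  "\<lbrakk>multilinear_map n E F A; x \<in> {..<n} \<rightarrow>\<^sub>E carrier E; i < n; y \<in> carrier E; z \<in> carrier E\<rbrakk>
    \<Longrightarrow> A (x(i := y \<oplus>\<^bsub>E\<^esub> z)) = A (x(i := y)) \<oplus>\<^bsub>F\<^esub> A (x(i := z))"
  by (simp add: multilinear_map_def)

lemma multilinear_map_smult:
  "\<lbrakk>multilinear_map n E F A; x \<in> {..<n} \<rightarrow>\<^sub>E carrier E; i < n; y \<in> carrier E\<rbrakk>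
    \<Longrightarrow> A (x(i := a \<odot>\<^bsub>E\<^esub> y)) = a \<odot>\<^bsub>F\<^esub> A (x(i := y))"
  by (simp add: multilinear_map_def)

lemma multilinear_mapI:
  assumes "\<And>x. x \<in> {..<n} \<rightarrow>\<^sub>E carrier E \<Longrightarrow> A x \<in> carrier F"
    and "\<And>x i y z. \<lbrakk>x \<in> {..<n} \<rightarrow>\<^sub>E carrier E; i < n; y \<in> carrier E; z \<in> carrier E\<rbrakk>
      \<Longrightarrow> A (x(i := y \<oplus>\<^bsub>E\<^esub> z)) = A (x(i := y)) \<oplus>\<^bsub>F\<^esub> A (x(i := z))"
    and "\<And>x i a y. \<lbrakk>x \<in> {..<n} \<rightarrow>\<^sub>E carrier E; i < n; y \<in> carrier E\<rbrakk>
      \<Longrightarrow> A (x(i := a \<odot>\<^bsub>E\<^esub> y)) = a \<odot>\<^bsub>F\<^esub> A (x(i := y))"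
  shows "multilinear_map n E F A"
  using assms by (simp add: multilinear_map_def)

lemma fun_upd_in_PiE_lessThan:
  "x \<in> {..<n} \<rightarrow>\<^sub>E C \<Longrightarrow> i < n \<Longrightarrow> y \<in> C \<Longrightarrow> x(i := y) \<in> {..<n::nat} \<rightarrow>\<^sub>E C"
  by (auto simp: PiE_iff extensional_def)

lemma multilinear_map_upd_closed:
  "\<lbrakk>multilinear_map n E F A; x \<in> {..<n} \<rightarrow>\<^sub>E carrier E; i < n; y \<in> carrier E\<rbrakk>
    \<Longrightarrow> A (x(i := y)) \<in> carrier F"
  by (rule multilinear_map_closed[OF _ fun_upd_in_PiE_lessThan])

text \<open>Maps on \<open>nat \<Rightarrow> 'v\<close> are only of interest on the extensional tuples, so multilinearity
  may be checked for any map that agrees with the given one there.\<close>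

lemma multilinear_map_cong:
  assumes A: "multilinear_map n E F A" and add: "\<And>y z. y \<in> carrier E \<Longrightarrow> z \<in> carrier E \<Longrightarrow> y \<oplus>\<^bsub>E\<^esub> z \<in> carrier E"
    and smult: "\<And>a y. y \<in> carrier E \<Longrightarrow> a \<odot>\<^bsub>E\<^esub> y \<in> carrier E"
    and eq: "\<And>x. x \<in> {..<n} \<rightarrow>\<^sub>E carrier E \<Longrightarrow> B x = A x"
  shows "multilinear_map n E F B"
proof (rule multilinear_mapI)
  have upd: "B (x(i := y)) = A (x(i := y))" if "x \<in> {..<n} \<rightarrow>\<^sub>E carrier E" "i < n" "y \<in> carrier E" for x i y
    by (rule eq[OF fun_upd_in_PiE_lessThan[OF that]])
  show "B (x(i := y \<oplus>\<^bsub>E\<^esub> z)) = B (x(i := y)) \<oplus>\<^bsub>F\<^esub> B (x(i := z))"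
    if "x \<in> {..<n} \<rightarrow>\<^sub>E carrier E" "i < n" "y \<in> carrier E" "z \<in> carrier E" for x i y z
    using that multilinear_map_add[OF A that] by (simp add: upd add)
  show "B (x(i := a \<odot>\<^bsub>E\<^esub> y)) = a \<odot>\<^bsub>F\<^esub> B (x(i := y))"
    if "x \<in> {..<n} \<rightarrow>\<^sub>E carrier E" "i < n" "y \<in> carrier E" for x i a y
    using that multilinear_map_smult[OF A that] by (simp add: upd smult)
qed (simp add: eq multilinear_map_closed[OF A])

locale normed_pair = E?: normed_space E + F?: normed_space F
  for E :: "('k::real_normed_field, 'v) nspace" and F :: "('k, 'w) nspace"
begin

lemma multilinear_map_zero: "multilinear_map n E F (\<lambda>x. \<zero>\<^bsub>F\<^esub>)"
  by (rule multilinear_mapI) simp_all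

lemma multilinear_map_plus:
  assumes "multilinear_map n E F A" "multilinear_map n E F B"
  shows "multilinear_map n E F (\<lambda>x. A x \<oplus>\<^bsub>F\<^esub> B x)"
proof (rule multilinear_mapI)
  fix x :: "nat \<Rightarrow> 'v" and i y z
  assume x: "x \<in> {..<n} \<rightarrow>\<^sub>E carrier E" "i < n" "y \<in> carrier E" "z \<in> carrier E"
  have "A (x(i := y)) \<in> carrier F" "A (x(i := z)) \<in> carrier F"
    "B (x(i := y)) \<in> carrier F" "B (x(i := z)) \<in> carrier F"
    using x by (simp_all add: multilinear_map_upd_closed[OF assms(1)] multilinear_map_upd_closed[OF assms(2)])
  then show "A (x(i := y \<oplus>\<^bsub>E\<^esub> z)) \<oplus>\<^bsub>F\<^esub> B (x(i := y \<oplus>\<^bsub>E\<^esub> z)) =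
      A (x(i := y)) \<oplus>\<^bsub>F\<^esub> B (x(i := y)) \<oplus>\<^bsub>F\<^esub> (A (x(i := z)) \<oplus>\<^bsub>F\<^esub> B (x(i := z)))"
    using x by (simp add: multilinear_map_add[OF assms(1)] multilinear_map_add[OF assms(2)] F.a_ac)
next
  fix x :: "nat \<Rightarrow> 'v" and i a y
  assume x: "x \<in> {..<n} \<rightarrow>\<^sub>E carrier E" "i < n" "y \<in> carrier E"
  have "A (x(i := y)) \<in> carrier F" "B (x(i := y)) \<in> carrier F"
    using x by (simp_all add: multilinear_map_upd_closed[OF assms(1)] multilinear_map_upd_closed[OF assms(2)])
  then show "A (x(i := a \<odot>\<^bsub>E\<^esub> y)) \<oplus>\<^bsub>F\<^esub> B (x(i := a \<odot>\<^bsub>E\<^esub> y)) =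
      a \<odot>\<^bsub>F\<^esub> (A (x(i := y)) \<oplus>\<^bsub>F\<^esub> B (x(i := y)))"
    using x by (simp add: multilinear_map_smult[OF assms(1)] multilinear_map_smult[OF assms(2)]
        F.smult_add_right)
qed (simp add: multilinear_map_closed[OF assms(1)] multilinear_map_closed[OF assms(2)])

lemma multilinear_map_scale:
  assumes "multilinear_map n E F A"
  shows "multilinear_map n E F (\<lambda>x. c \<odot>\<^bsub>F\<^esub> A x)"
proof (rule multilinear_mapI)
  fix x :: "nat \<Rightarrow> 'v" and i y z
  assume x: "x \<in> {..<n} \<rightarrow>\<^sub>E carrier E" "i < n" "y \<in> carrier E" "z \<in> carrier E"
  have "A (x(i := y)) \<in> carrier F" "A (x(i := z)) \<in> carrier F"
    using x by (simp_all add: multilinear_map_upd_closed[OF assms])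
  then show "c \<odot>\<^bsub>F\<^esub> A (x(i := y \<oplus>\<^bsub>E\<^esub> z)) = c \<odot>\<^bsub>F\<^esub> A (x(i := y)) \<oplus>\<^bsub>F\<^esub> c \<odot>\<^bsub>F\<^esub> A (x(i := z))"
    using x by (simp add: multilinear_map_add[OF assms(1)] F.smult_add_right)
next
  fix x :: "nat \<Rightarrow> 'v" and i a y
  assume x: "x \<in> {..<n} \<rightarrow>\<^sub>E carrier E" "i < n" "y \<in> carrier E"
  have "A (x(i := y)) \<in> carrier F"
    using x by (simp_all add: multilinear_map_upd_closed[OF assms])
  then show "c \<odot>\<^bsub>F\<^esub> A (x(i := a \<odot>\<^bsub>E\<^esub> y)) = a \<odot>\<^bsub>F\<^esub> (c \<odot>\<^bsub>F\<^esub> A (x(i := y)))"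
    using x by (simp add: multilinear_map_smult[OF assms(1)] F.smult_assoc mult.commute)
qed (simp add: multilinear_map_closed[OF assms])

lemma multilinear_map_finsum:
  assumes "finite I" "\<And>f. f \<in> I \<Longrightarrow> multilinear_map n E F (A f)"
  shows "multilinear_map n E F (\<lambda>x. \<Oplus>\<^bsub>F\<^esub>f\<in>I. A f x)"
  using assms
proof induction
  case empty
  then show ?case
    using multilinear_map_zero by simp
next
  case (insert a I)
  have "multilinear_map n E F (\<lambda>x. A a x \<oplus>\<^bsub>F\<^esub> (\<Oplus>\<^bsub>F\<^esub>f\<in>I. A f x))"
    using insert by (intro multilinear_map_plus) simp_all
  then show ?case
  proof (rule multilinear_map_cong)
    fix x
    assume "x \<in> {..<n} \<rightarrow>\<^sub>E carrier E"
    then have "A f x \<in> carrier F" if "f \<in> insert a I" for f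
      using multilinear_map_closed[OF insert.prems[OF that]] by simp
    then show "(\<Oplus>\<^bsub>F\<^esub>f\<in>insert a I. A f x) = A a x \<oplus>\<^bsub>F\<^esub> (\<Oplus>\<^bsub>F\<^esub>f\<in>I. A f x)"
      using insert.hyps by (simp add: Pi_def)
  qed simp_all
qed

lemma multilinear_map_permute:
  assumes A: "multilinear_map n E F A" and f: "bij_betw f {..<n} {..<n}"
  shows "multilinear_map n E F (\<lambda>x. A (\<lambda>i\<in>{..<n}. x (f i)))"
proof -
  define g where "g = the_inv_into {..<n} f"
  have inv: "g i < n" if "i < n" for i
    using bij_betwE[OF bij_betw_the_inv_into[OF f]] that by (simp add: g_def)
  have fg: "f (g i) = i" if "i < n" for i
    using f_the_inv_into_f_bij_betw[OF f] that by (simp add: g_def)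
  have gf: "g (f j) = j" if "j < n" for j
    using that f by (simp add: g_def bij_betw_def the_inv_into_f_f)
  have upd: "(\<lambda>j\<in>{..<n}. (x(i := y)) (f j)) = (\<lambda>j\<in>{..<n}. x (f j))(g i := y)"
    if "i < n" for x :: "nat \<Rightarrow> 'v" and i y
  proof
    fix j
    show "(\<lambda>j\<in>{..<n}. (x(i := y)) (f j)) j = ((\<lambda>j\<in>{..<n}. x (f j))(g i := y)) j"
      using inv[OF that] fg[OF that] gf[of j] by auto
  qed
  have cl: "(\<lambda>j\<in>{..<n}. x (f j)) \<in> {..<n} \<rightarrow>\<^sub>E carrier E" if "x \<in> {..<n} \<rightarrow>\<^sub>E carrier E" for x
    using that bij_betwE[OF f] by (auto simp: PiE_iff)
  show ?thesis
    by (rule multilinear_mapI)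
      (simp_all only: upd multilinear_map_add[OF A cl inv] multilinear_map_smult[OF A cl inv]
        multilinear_map_closed[OF A cl])
qed

lemma multilinear_map_limit:
  assumes A: "\<And>j. multilinear_map n E F (A j)"
    and lim: "\<And>x. x \<in> {..<n} \<rightarrow>\<^sub>E carrier E \<Longrightarrow> F.tends_to (\<lambda>j. A j x) (L x)"
  shows "multilinear_map n E F L"
proof (rule multilinear_mapI)
  fix x :: "nat \<Rightarrow> 'v" and i y z
  assume x: "x \<in> {..<n} \<rightarrow>\<^sub>E carrier E" "i < n" "y \<in> carrier E" "z \<in> carrier E"
  have "F.tends_to (\<lambda>j. A j (x(i := y \<oplus>\<^bsub>E\<^esub> z))) (L (x(i := y)) \<oplus>\<^bsub>F\<^esub> L (x(i := z)))"
    unfolding multilinear_map_add[OF A x]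
    by (intro F.tends_to_add lim fun_upd_in_PiE_lessThan x)
  moreover have "F.tends_to (\<lambda>j. A j (x(i := y \<oplus>\<^bsub>E\<^esub> z))) (L (x(i := y \<oplus>\<^bsub>E\<^esub> z)))"
    by (intro lim fun_upd_in_PiE_lessThan x E.a_closed)
  ultimately show "L (x(i := y \<oplus>\<^bsub>E\<^esub> z)) = L (x(i := y)) \<oplus>\<^bsub>F\<^esub> L (x(i := z))"
    by (rule F.tends_to_unique[rotated])
next
  fix x :: "nat \<Rightarrow> 'v" and i a y
  assume x: "x \<in> {..<n} \<rightarrow>\<^sub>E carrier E" "i < n" "y \<in> carrier E"
  have "F.tends_to (\<lambda>j. A j (x(i := a \<odot>\<^bsub>E\<^esub> y))) (a \<odot>\<^bsub>F\<^esub> L (x(i := y)))"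
    unfolding multilinear_map_smult[OF A x]
    by (intro F.tends_to_smult lim fun_upd_in_PiE_lessThan x)
  moreover have "F.tends_to (\<lambda>j. A j (x(i := a \<odot>\<^bsub>E\<^esub> y))) (L (x(i := a \<odot>\<^bsub>E\<^esub> y)))"
    by (intro lim fun_upd_in_PiE_lessThan x E.smult_closed)
  ultimately show "L (x(i := a \<odot>\<^bsub>E\<^esub> y)) = a \<odot>\<^bsub>F\<^esub> L (x(i := y))"
    by (rule F.tends_to_unique[rotated])
qed (use lim F.tends_to_def in blast)

lemma multilinear_map_zero_arg:
  assumes A: "multilinear_map n E F A" and x: "x \<in> {..<n} \<rightarrow>\<^sub>E carrier E" and i: "i < n"
  shows "A (x(i := \<zero>\<^bsub>E\<^esub>)) = \<zero>\<^bsub>F\<^esub>"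
  using multilinear_map_smult[OF A x i, of "\<zero>\<^bsub>E\<^esub>" 0]
    multilinear_map_closed[OF A fun_upd_in_PiE_lessThan[OF x i, of "\<zero>\<^bsub>E\<^esub>"]]
  by simp

lemma multilinear_map_finsum_arg:
  assumes A: "multilinear_map n E F A" and x: "x \<in> {..<n} \<rightarrow>\<^sub>E carrier E" and i: "i < n"
    and S: "finite S" "v \<in> S \<rightarrow> carrier E"
  shows "A (x(i := \<Oplus>\<^bsub>E\<^esub>a\<in>S. v a)) = (\<Oplus>\<^bsub>F\<^esub>a\<in>S. A (x(i := v a)))"
proof -
  define B where "B y = A (x(i := y))" for y
  have closed: "B y \<in> carrier F" if "y \<in> carrier E" for y
    unfolding B_def using multilinear_map_upd_closed[OF A x i that] .
  have zero: "B \<zero>\<^bsub>E\<^esub> = \<zero>\<^bsub>F\<^esub>"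
    unfolding B_def by (rule multilinear_map_zero_arg[OF A x i])
  have add: "B (y \<oplus>\<^bsub>E\<^esub> z) = B y \<oplus>\<^bsub>F\<^esub> B z" if "y \<in> carrier E" "z \<in> carrier E" for y z
    unfolding B_def using multilinear_map_add[OF A x i that] .
  from S have "B (\<Oplus>\<^bsub>E\<^esub>a\<in>S. v a) = (\<Oplus>\<^bsub>F\<^esub>a\<in>S. B (v a))"
    by induction (simp_all add: zero add closed Pi_def)
  then show ?thesis
    by (simp only: B_def)
qed

text \<open>The multinomial expansion of \<open>A(s, \<dots>, s)\<close> for a finite sum \<open>s\<close>; the coordinates are
  expanded one after the other.\<close>

lemma multilinear_map_expand:
  assumes A: "multilinear_map n E F A" and S: "finite S" "v \<in> S \<rightarrow> carrier E"
    and m: "m \<le> n" and y: "y \<in> {..<n} \<rightarrow>\<^sub>E carrier E"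
  shows "A (\<lambda>i\<in>{..<n}. if i < m then (\<Oplus>\<^bsub>E\<^esub>a\<in>S. v a) else y i) =
    (\<Oplus>\<^bsub>F\<^esub>f\<in>{..<m} \<rightarrow>\<^sub>E S. A (\<lambda>i\<in>{..<n}. if i < m then v (f i) else y i))"
  using m y
proof (induction m arbitrary: y)
  case 0
  have "(\<lambda>i\<in>{..<n}. y i) = y"
    using 0 by auto
  then show ?case
    using multilinear_map_closed[OF A 0(2)] by simp
next
  case (Suc m)
  let ?s = "\<Oplus>\<^bsub>E\<^esub>a\<in>S. v a"
  let ?t = "\<lambda>f y. \<lambda>i\<in>{..<n}. if i < m then v (f i) else y i"
  let ?T = "\<lambda>f. \<lambda>i\<in>{..<n}. if i < Suc m then v (f i) else y i"
  have s: "?s \<in> carrier E"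
    using S by simp
  have y': "y(m := ?s) \<in> {..<n} \<rightarrow>\<^sub>E carrier E"
    using Suc.prems s by (intro fun_upd_in_PiE_lessThan) auto
  have fin: "finite ({..<m} \<rightarrow>\<^sub>E S)"
    using S by (intro finite_PiE) auto
  have t: "?t f y \<in> {..<n} \<rightarrow>\<^sub>E carrier E" if "f \<in> {..<m} \<rightarrow>\<^sub>E S" for f
    using that S Suc.prems by (auto simp: PiE_iff)
  have T: "?T f \<in> {..<n} \<rightarrow>\<^sub>E carrier E" if "f \<in> {..<Suc m} \<rightarrow>\<^sub>E S" for f
    using that S Suc.prems by (auto simp: PiE_iff)
  have AT: "A (?T f) \<in> carrier F" if "f \<in> {..<Suc m} \<rightarrow>\<^sub>E S" for f
    by (rule multilinear_map_closed[OF A T[OF that]])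
  have upd: "f(m := a) \<in> {..<Suc m} \<rightarrow>\<^sub>E S" if "f \<in> {..<m} \<rightarrow>\<^sub>E S" "a \<in> S" for f a
    using that by (auto simp: PiE_iff extensional_def)
  have "(\<lambda>i\<in>{..<n}. if i < Suc m then ?s else y i) = (\<lambda>i\<in>{..<n}. if i < m then ?s else (y(m := ?s)) i)"
    by (auto simp: fun_eq_iff less_Suc_eq)
  then have "A (\<lambda>i\<in>{..<n}. if i < Suc m then ?s else y i) =
      (\<Oplus>\<^bsub>F\<^esub>f\<in>{..<m} \<rightarrow>\<^sub>E S. A (?t f (y(m := ?s))))"
    using Suc.IH[OF Suc_leD[OF Suc.prems(1)] y'] by (simp only:)
  also have "\<dots> = (\<Oplus>\<^bsub>F\<^esub>f\<in>{..<m} \<rightarrow>\<^sub>E S. \<Oplus>\<^bsub>F\<^esub>h\<in>(\<lambda>a. f(m := a)) ` S. A (?T h))"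
  proof (rule F.finsum_cong')
    show "(\<lambda>f. \<Oplus>\<^bsub>F\<^esub>h\<in>(\<lambda>a. f(m := a)) ` S. A (?T h)) \<in> ({..<m} \<rightarrow>\<^sub>E S) \<rightarrow> carrier F"
      by (intro funcsetI F.finsum_closed, elim imageE, simp only: AT upd)
    fix f
    assume f: "f \<in> {..<m} \<rightarrow>\<^sub>E S"
    have "?t f (y(m := ?s)) = (?t f y)(m := ?s)"
      using Suc.prems by (auto simp: fun_eq_iff)
    then have "A (?t f (y(m := ?s))) = (\<Oplus>\<^bsub>F\<^esub>a\<in>S. A ((?t f y)(m := v a)))"
      using multilinear_map_finsum_arg[OF A t[OF f] Suc_le_lessD[OF Suc.prems(1)] S] by (simp only:)
    also have "\<dots> = (\<Oplus>\<^bsub>F\<^esub>a\<in>S. A (?T (f(m := a))))"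
    proof -
      have "(?t f y)(m := v a) = ?T (f(m := a))" for a
        using Suc.prems by (auto simp: fun_eq_iff less_Suc_eq)
      then show ?thesis
        by (simp only:)
    qed
    also have "\<dots> = (\<Oplus>\<^bsub>F\<^esub>h\<in>(\<lambda>a. f(m := a)) ` S. A (?T h))"
    proof (rule F.finsum_reindex[symmetric])
      show "(\<lambda>h. A (?T h)) \<in> (\<lambda>a. f(m := a)) ` S \<rightarrow> carrier F"
        by (intro funcsetI, elim imageE, simp only: AT upd[OF f])
      show "inj_on (\<lambda>a. f(m := a)) S"
        by (metis fun_upd_same inj_onI)
    qed
    finally show "A (?t f (y(m := ?s))) = (\<Oplus>\<^bsub>F\<^esub>h\<in>(\<lambda>a. f(m := a)) ` S. A (?T h))" .
  qed simp
  also have "\<dots> = (\<Oplus>\<^bsub>F\<^esub>h\<in>(\<Union>f\<in>{..<m} \<rightarrow>\<^sub>E S. (\<lambda>a. f(m := a)) ` S). A (?T h))"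
  proof (rule F.add.finprod_UN_disjoint[symmetric])
    show "pairwise (\<lambda>f g. disjnt ((\<lambda>a. f(m := a)) ` S) ((\<lambda>a. g(m := a)) ` S)) ({..<m} \<rightarrow>\<^sub>E S)"
    proof (intro pairwiseI)
      fix f g
      assume fg: "f \<in> {..<m} \<rightarrow>\<^sub>E S" "g \<in> {..<m} \<rightarrow>\<^sub>E S" "f \<noteq> g"
      then obtain i where i: "i < m" "f i \<noteq> g i"
        by (metis PiE_ext lessThan_iff)
      have "f(m := a) \<noteq> g(m := b)" for a b
        using i by (metis fun_upd_other nat_neq_iff)
      then show "disjnt ((\<lambda>a. f(m := a)) ` S) ((\<lambda>a. g(m := a)) ` S)"
        by (auto simp: disjnt_def)
    qed
    fix f h
    assume "f \<in> {..<m} \<rightarrow>\<^sub>E S" "h \<in> (\<lambda>a. f(m := a)) ` S"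
    then have "h \<in> {..<Suc m} \<rightarrow>\<^sub>E S"
      using upd by blast
    then show "A (?T h) \<in> carrier F"
      by (rule AT)
  qed (use fin S in auto)
  also have "(\<Union>f\<in>{..<m} \<rightarrow>\<^sub>E S. (\<lambda>a. f(m := a)) ` S) = {..<Suc m} \<rightarrow>\<^sub>E S"
    by (auto simp: lessThan_Suc PiE_insert_eq)
  finally show ?case .
qed

text \<open>The part of the expansion of \<open>A(s, \<dots>, s)\<close>, where \<open>s\<close> is the sum of the \<open>x\<^sub>j\<close> with
  \<open>j \<in> U \<union> S\<close>, that consists of the terms in which every \<open>x\<^sub>j\<close> with \<open>j \<in> U\<close> occurs.
  For \<open>U = {..<n}\<close> and \<open>S = {}\<close> it is the symmetrization of \<open>A\<close>, without the factor \<open>1/n!\<close>.\<close>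

definition hitting_part ::
  "nat \<Rightarrow> ((nat \<Rightarrow> 'v) \<Rightarrow> 'w) \<Rightarrow> (nat \<Rightarrow> 'v) \<Rightarrow> nat set \<Rightarrow> nat set \<Rightarrow> 'w" where
  "hitting_part n A x U S =
    (\<Oplus>\<^bsub>F\<^esub>f\<in>{f \<in> {..<n} \<rightarrow>\<^sub>E U \<union> S. U \<subseteq> f ` {..<n}}. A (\<lambda>i\<in>{..<n}. x (f i)))"

lemma finite_hitting: "finite U \<Longrightarrow> finite S \<Longrightarrow> finite {f \<in> {..<n::nat} \<rightarrow>\<^sub>E U \<union> S. U \<subseteq> f ` {..<n}}"
  by (rule finite_subset[of _ "{..<n} \<rightarrow>\<^sub>E U \<union> S"]) (auto intro: finite_PiE)

lemma hitting_term_closed: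
  assumes "multilinear_map n E F A" "x \<in> {..<n} \<rightarrow>\<^sub>E carrier E" "f \<in> {..<n} \<rightarrow>\<^sub>E T" "T \<subseteq> {..<n}"
  shows "A (\<lambda>i\<in>{..<n}. x (f i)) \<in> carrier F"
  by (rule multilinear_map_closed[OF assms(1)]) (use assms(2-4) in \<open>auto simp: PiE_iff\<close>)

lemma hitting_part_closed:
  assumes "multilinear_map n E F A" "x \<in> {..<n} \<rightarrow>\<^sub>E carrier E" "U \<union> S \<subseteq> {..<n}"
  shows "hitting_part n A x U S \<in> carrier F"
  unfolding hitting_part_def
  using hitting_term_closed[OF assms(1,2) _ assms(3)] by (intro F.finsum_closed) auto

lemma hitting_part_empty:
  assumes A: "multilinear_map n E F A" and x: "x \<in> {..<n} \<rightarrow>\<^sub>E carrier E" and S: "S \<subseteq> {..<n}"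
  shows "hitting_part n A x {} S = A (\<lambda>i\<in>{..<n}. \<Oplus>\<^bsub>E\<^esub>j\<in>S. x j)"
proof -
  have fin: "finite S" and v: "x \<in> S \<rightarrow> carrier E"
    using S x finite_subset by (auto simp: PiE_iff)
  have "A (\<lambda>i\<in>{..<n}. if i < n then \<Oplus>\<^bsub>E\<^esub>j\<in>S. x j else x i) =
      (\<Oplus>\<^bsub>F\<^esub>f\<in>{..<n} \<rightarrow>\<^sub>E S. A (\<lambda>i\<in>{..<n}. if i < n then x (f i) else x i))"
    by (rule multilinear_map_expand[OF A fin v _ x]) simp
  moreover have "(\<lambda>i\<in>{..<n}. if i < n then c i else x i) = (\<lambda>i\<in>{..<n}. c i)" for c
    by auto
  ultimately show ?thesis
    by (simp add: hitting_part_def)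
qed

text \<open>Inclusion--exclusion, one index at a time: an index map into \<open>U \<union> S \<union> {a}\<close> that hits \<open>U\<close>
  either misses \<open>a\<close> or hits all of \<open>U \<union> {a}\<close>.\<close>

lemma hitting_part_insert:
  assumes A: "multilinear_map n E F A" and x: "x \<in> {..<n} \<rightarrow>\<^sub>E carrier E"
    and US: "insert a (U \<union> S) \<subseteq> {..<n}" and a: "a \<notin> U" "a \<notin> S"
  shows "hitting_part n A x (insert a U) S =
    hitting_part n A x U (insert a S) \<ominus>\<^bsub>F\<^esub> hitting_part n A x U S"
proof -
  let ?H = "\<lambda>U S. {f \<in> {..<n} \<rightarrow>\<^sub>E U \<union> S. U \<subseteq> f ` {..<n}}"
  have fin: "finite U" "finite S"
    using US by (auto intro: finite_subset[of _ "{..<n}"])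
  have "?H U (insert a S) = ?H U S \<union> ?H (insert a U) S"
    by (auto simp: PiE_iff)
  moreover have "?H U S \<inter> ?H (insert a U) S = {}"
    using a by (auto simp: PiE_iff)
  ultimately have "hitting_part n A x U (insert a S) =
      hitting_part n A x U S \<oplus>\<^bsub>F\<^esub> hitting_part n A x (insert a U) S"
    unfolding hitting_part_def
    using F.finsum_Un_disjoint[of "?H U S" "?H (insert a U) S" "\<lambda>f. A (\<lambda>i\<in>{..<n}. x (f i))"]
      hitting_term_closed[OF A x, of _ "U \<union> S"] hitting_term_closed[OF A x, of _ "insert a U \<union> S"]
      finite_hitting[of U S n] finite_hitting[of "insert a U" S n] fin US
    by simp
  then show ?thesis
    using US hitting_part_closed[OF A x, of U S] hitting_part_closed[OF A x, of "insert a U" S]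
    by (simp add: F.add_diff_cancel)
qed

lemma bij_betw_hitting:
  assumes "f \<in> {..<n::nat} \<rightarrow>\<^sub>E {..<n} \<union> {}" "{..<n} \<subseteq> f ` {..<n}"
  shows "bij_betw f {..<n} {..<n}"
proof -
  have "f ` {..<n} = {..<n}"
    using assms by (auto simp: PiE_iff)
  then show ?thesis
    by (simp add: bij_betw_def eq_card_imp_inj_on)
qed

lemma multilinear_map_symmetrization:
  assumes A: "multilinear_map n E F A"
  shows "multilinear_map n E F (\<lambda>x. hitting_part n A x {..<n} {})"
  unfolding hitting_part_def
proof (rule multilinear_map_finsum[OF finite_hitting])
  fix f
  assume "f \<in> {f \<in> {..<n} \<rightarrow>\<^sub>E {..<n} \<union> {}. {..<n} \<subseteq> f ` {..<n}}"
  then have "bij_betw f {..<n} {..<n}"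
    by (intro bij_betw_hitting) auto
  then show "multilinear_map n E F (\<lambda>x. A (\<lambda>i\<in>{..<n}. x (f i)))"
    by (rule multilinear_map_permute[OF A])
qed simp_all

lemma symmetrization_diagonal:
  assumes A: "multilinear_map n E F A" and x: "x \<in> carrier E"
  shows "hitting_part n A (\<lambda>i\<in>{..<n}. x) {..<n} {} =
    of_nat (card {f \<in> {..<n} \<rightarrow>\<^sub>E {..<n} \<union> {}. {..<n} \<subseteq> f ` {..<n}}) \<odot>\<^bsub>F\<^esub> A (\<lambda>i\<in>{..<n}. x)"
proof -
  let ?H = "{f \<in> {..<n} \<rightarrow>\<^sub>E {..<n} \<union> {}. {..<n} \<subseteq> f ` {..<n}}"
  have cl: "A (\<lambda>i\<in>{..<n}. x) \<in> carrier F"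
    using x by (intro multilinear_map_closed[OF A]) simp
  have "hitting_part n A (\<lambda>i\<in>{..<n}. x) {..<n} {} = (\<Oplus>\<^bsub>F\<^esub>f\<in>?H. A (\<lambda>i\<in>{..<n}. x))"
    unfolding hitting_part_def
  proof (rule F.finsum_cong'[OF refl])
    fix f
    assume "f \<in> ?H"
    then have "(\<lambda>i\<in>{..<n}. (\<lambda>i\<in>{..<n}. x) (f i)) = (\<lambda>i\<in>{..<n}. x)"
      by (auto simp: PiE_iff fun_eq_iff)
    then show "A (\<lambda>i\<in>{..<n}. (\<lambda>i\<in>{..<n}. x) (f i)) = A (\<lambda>i\<in>{..<n}. x)"
      by (simp only:)
  qed (use cl in auto)
  also have "\<dots> = of_nat (card ?H) \<odot>\<^bsub>F\<^esub> A (\<lambda>i\<in>{..<n}. x)"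
    using finite_hitting[of "{..<n}" "{}" n] cl by (intro F.finsum_const_smult) auto
  finally show ?thesis .
qed

text \<open>By inclusion--exclusion the symmetrization of \<open>A\<close> is a fixed combination of values of
  the map \<open>x \<mapsto> A(x, \<dots>, x)\<close>.  Hence it inherits pointwise convergence from these maps,
  although the multilinear maps themselves need not converge.\<close>

lemma multilinear_diagonal_limit:
  assumes A: "\<And>j. multilinear_map n E F (A j)"
    and lim: "\<And>x. x \<in> carrier E \<Longrightarrow> F.tends_to (\<lambda>j. A j (\<lambda>i\<in>{..<n}. x)) (P x)"
  shows "\<exists>L. multilinear_map n E F L \<and> (\<forall>x\<in>carrier E. P x = L (\<lambda>i\<in>{..<n}. x))"
proof -
  define c :: 'k where "c = of_nat (card {f \<in> {..<n} \<rightarrow>\<^sub>E {..<n} \<union> {}. {..<n} \<subseteq> f ` {..<n}})"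
  have "(\<lambda>i\<in>{..<n}. i) \<in> {f \<in> {..<n} \<rightarrow>\<^sub>E {..<n} \<union> {}. {..<n} \<subseteq> f ` {..<n}}"
    by auto
  then have c: "c \<noteq> 0"
    using finite_hitting[of "{..<n}" "{}" n] by (auto simp only: c_def of_nat_eq_0_iff card_eq_0_iff)
  \<comment> \<open>The \<open>U = {}\<close> case is convergence on the diagonal; each index moved into \<open>U\<close> costs a difference.\<close>
  have conv: "\<exists>l. F.tends_to (\<lambda>j. hitting_part n (A j) x U S) l"
    if x: "x \<in> {..<n} \<rightarrow>\<^sub>E carrier E" and "finite U" "U \<union> S \<subseteq> {..<n}" "U \<inter> S = {}" for x U S
    using that(2-)
  proof (induction U arbitrary: S)
    case empty
    then have "finite S"
      by (auto intro: finite_subset)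
    then have "(\<Oplus>\<^bsub>E\<^esub>j\<in>S. x j) \<in> carrier E"
      using x empty by (intro E.finsum_closed) (auto simp: PiE_iff)
    then show ?case
      using lim hitting_part_empty[OF A x] empty by auto
  next
    case (insert a U)
    have "\<exists>l. F.tends_to (\<lambda>j. hitting_part n (A j) x U (insert a S)) l"
      "\<exists>l. F.tends_to (\<lambda>j. hitting_part n (A j) x U S) l"
      using insert.hyps insert.prems by (auto intro!: insert.IH)
    then obtain l m where "F.tends_to (\<lambda>j. hitting_part n (A j) x U (insert a S)) l"
      "F.tends_to (\<lambda>j. hitting_part n (A j) x U S) m"
      by blast
    then have "F.tends_to (\<lambda>j. hitting_part n (A j) x U (insert a S) \<ominus>\<^bsub>F\<^esub> hitting_part n (A j) x U S)
        (l \<ominus>\<^bsub>F\<^esub> m)"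
      by (rule F.tends_to_diff)
    moreover have "hitting_part n (A j) x (insert a U) S =
        hitting_part n (A j) x U (insert a S) \<ominus>\<^bsub>F\<^esub> hitting_part n (A j) x U S" for j
      using insert.hyps insert.prems by (intro hitting_part_insert[OF A x]) auto
    ultimately show ?case
      by auto
  qed
  then have "\<forall>x\<in>{..<n} \<rightarrow>\<^sub>E carrier E. \<exists>l. F.tends_to (\<lambda>j. hitting_part n (A j) x {..<n} {}) l"
    by simp
  then obtain L where L: "\<And>x. x \<in> {..<n} \<rightarrow>\<^sub>E carrier E \<Longrightarrow>
      F.tends_to (\<lambda>j. hitting_part n (A j) x {..<n} {}) (L x)"
    unfolding bchoice_iff by blast
  have "multilinear_map n E F (\<lambda>x. inverse c \<odot>\<^bsub>F\<^esub> L x)"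
    by (rule multilinear_map_scale[OF multilinear_map_limit[OF multilinear_map_symmetrization[OF A] L]])
  moreover have "P x = inverse c \<odot>\<^bsub>F\<^esub> L (\<lambda>i\<in>{..<n}. x)" if x: "x \<in> carrier E" for x
  proof -
    have "F.tends_to (\<lambda>j. hitting_part n (A j) (\<lambda>i\<in>{..<n}. x) {..<n} {}) (c \<odot>\<^bsub>F\<^esub> P x)"
      unfolding symmetrization_diagonal[OF A x] c_def by (rule F.tends_to_smult[OF lim[OF x]])
    moreover have "F.tends_to (\<lambda>j. hitting_part n (A j) (\<lambda>i\<in>{..<n}. x) {..<n} {}) (L (\<lambda>i\<in>{..<n}. x))"
      using x by (intro L) simp
    ultimately have "c \<odot>\<^bsub>F\<^esub> P x = L (\<lambda>i\<in>{..<n}. x)"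
      by (rule F.tends_to_unique)
    moreover have "P x \<in> carrier F"
      using lim[OF x] by (simp add: F.tends_to_def)
    ultimately show ?thesis
      using c by (simp add: F.smult_assoc flip: \<open>c \<odot>\<^bsub>F\<^esub> P x = _\<close>)
  qed
  ultimately show ?thesis
    by blast
qed

end

section \<open>Continuous homogeneous polynomials\<close>

lemma continuous_map_on_cong:
  assumes "continuous_map_on E F f" "\<And>x. x \<in> carrier E \<Longrightarrow> g x = f x"
  shows "continuous_map_on E F g"
  using assms by (simp add: continuous_map_on_def)

lemma continuous_map_on_compose:
  assumes "continuous_map_on G E f" "continuous_map_on E F g" "\<And>x. x \<in> carrier G \<Longrightarrow> f x \<in> carrier E"
  shows "continuous_map_on G F (\<lambda>x. g (f x))"
  unfolding continuous_map_on_def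
proof (intro ballI allI impI)
  fix x and e :: real
  assume x: "x \<in> carrier G" and e: "0 < e"
  obtain d where d: "0 < d" "\<And>y. y \<in> carrier E \<Longrightarrow> vnorm E (y \<ominus>\<^bsub>E\<^esub> f x) < d
      \<Longrightarrow> vnorm F (g y \<ominus>\<^bsub>F\<^esub> g (f x)) < e"
    using assms(2) assms(3)[OF x] e unfolding continuous_map_on_def by blast
  obtain c where "0 < c" "\<And>y. y \<in> carrier G \<Longrightarrow> vnorm G (y \<ominus>\<^bsub>G\<^esub> x) < c
      \<Longrightarrow> vnorm E (f y \<ominus>\<^bsub>E\<^esub> f x) < d"
    using assms(1) x d(1) unfolding continuous_map_on_def by blast
  then show "\<exists>d>0. \<forall>y\<in>carrier G. vnorm G (y \<ominus>\<^bsub>G\<^esub> x) < d \<longrightarrow> vnorm F (g (f y) \<ominus>\<^bsub>F\<^esub> g (f x)) < e"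
    using d(2) assms(3) by blast
qed

lemma cpoly_extensional: "P \<in> cpoly n E F \<Longrightarrow> P \<in> extensional (carrier E)"
  by (simp add: cpoly_def PiE_iff)

lemma cpoly_closed [simp, intro]: "P \<in> cpoly n E F \<Longrightarrow> x \<in> carrier E \<Longrightarrow> P x \<in> carrier F"
  by (auto simp: cpoly_def)

lemma cpoly_continuous: "P \<in> cpoly n E F \<Longrightarrow> continuous_map_on E F P"
  by (simp add: cpoly_def)

lemma cpoly_multilinear:
  assumes "P \<in> cpoly n E F"
  obtains A where "multilinear_map n E F A" "\<And>x. x \<in> carrier E \<Longrightarrow> P x = A (\<lambda>i\<in>{..<n}. x)"
  using assms by (auto simp: cpoly_def)

lemma cpolyI:
  assumes "P \<in> extensional (carrier E)" "multilinear_map n E F A"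
    and "\<And>x. x \<in> carrier E \<Longrightarrow> P x = A (\<lambda>i\<in>{..<n}. x)"
    and "continuous_map_on E F P"
  shows "P \<in> cpoly n E F"
proof -
  have "P x \<in> carrier F" if "x \<in> carrier E" for x
    unfolding assms(3)[OF that] by (rule multilinear_map_closed[OF assms(2)]) (use that in simp)
  then have "P \<in> carrier E \<rightarrow>\<^sub>E carrier F"
    using assms(1) by (simp add: PiE_iff)
  then show ?thesis
    unfolding cpoly_def using assms(2-4) by blast
qed

lemma cpoly_ext:
  assumes "P \<in> cpoly n E F" "Q \<in> cpoly n E F" "\<And>x. x \<in> carrier E \<Longrightarrow> P x = Q x"
  shows "P = Q"
  using cpoly_extensional[OF assms(1)] cpoly_extensional[OF assms(2)] assms(3)
  by (rule extensionalityI)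

context normed_pair
begin

lemma cpoly_homogeneous:
  assumes P: "P \<in> cpoly n E F" and x: "x \<in> carrier E"
  shows "P (a \<odot>\<^bsub>E\<^esub> x) = a ^ n \<odot>\<^bsub>F\<^esub> P x"
proof -
  obtain A where A: "multilinear_map n E F A" and PA: "\<And>x. x \<in> carrier E \<Longrightarrow> P x = A (\<lambda>i\<in>{..<n}. x)"
    using P by (rule cpoly_multilinear) blast
  have "A (\<lambda>i\<in>{..<n}. if i < m then a \<odot>\<^bsub>E\<^esub> x else x) = a ^ m \<odot>\<^bsub>F\<^esub> P x" if "m \<le> n" for m
    using that
  proof (induction m)
    case 0
    have "(\<lambda>i\<in>{..<n}. if i < 0 then a \<odot>\<^bsub>E\<^esub> x else x) = (\<lambda>i\<in>{..<n}. x)"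
      by auto
    then show ?case
      using F.smult_one[OF cpoly_closed[OF P x]] by (simp only: power_0 PA[OF x])
  next
    case (Suc m)
    let ?y = "\<lambda>i\<in>{..<n}. if i < m then a \<odot>\<^bsub>E\<^esub> x else x"
    have y: "?y \<in> {..<n} \<rightarrow>\<^sub>E carrier E"
      using x by auto
    have "(\<lambda>i\<in>{..<n}. if i < Suc m then a \<odot>\<^bsub>E\<^esub> x else x) = ?y(m := a \<odot>\<^bsub>E\<^esub> x)"
      using Suc.prems by (auto simp: fun_eq_iff less_Suc_eq)
    moreover have "?y = ?y(m := x)"
      using Suc.prems by (auto simp: fun_eq_iff)
    ultimately have "A (\<lambda>i\<in>{..<n}. if i < Suc m then a \<odot>\<^bsub>E\<^esub> x else x) = a \<odot>\<^bsub>F\<^esub> A ?y"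
      using multilinear_map_smult[OF A y Suc_le_lessD[OF Suc.prems] x] by metis
    also have "A ?y = a ^ m \<odot>\<^bsub>F\<^esub> P x"
      using Suc.prems by (intro Suc.IH) simp
    finally show ?case
      using P x by (simp add: F.smult_assoc cpoly_closed)
  qed
  from this[OF order_refl]
  have "A (\<lambda>i\<in>{..<n}. if i < n then a \<odot>\<^bsub>E\<^esub> x else x) = a ^ n \<odot>\<^bsub>F\<^esub> P x" .
  moreover have "(\<lambda>i\<in>{..<n}. if i < n then a \<odot>\<^bsub>E\<^esub> x else x) = (\<lambda>i\<in>{..<n}. a \<odot>\<^bsub>E\<^esub> x)"
    by auto
  ultimately show ?thesis
    using x by (simp only: PA E.smult_closed)
qed

lemma cpoly_at_zero:
  assumes "P \<in> cpoly n E F" "1 \<le> n"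
  shows "P \<zero>\<^bsub>E\<^esub> = \<zero>\<^bsub>F\<^esub>"
  using cpoly_homogeneous[OF assms(1), of "\<zero>\<^bsub>E\<^esub>" 0] assms
    cpoly_closed[OF assms(1), of "\<zero>\<^bsub>E\<^esub>"] by (simp add: power_0_left)

text \<open>Continuity at \<open>0\<close> bounds \<open>P\<close> on a small ball, and homogeneity carries the bound to
  the whole space.\<close>

lemma cpoly_bounded:
  assumes P: "P \<in> cpoly n E F" and n: "1 \<le> n"
  shows "\<exists>B\<ge>0. \<forall>x\<in>carrier E. vnorm F (P x) \<le> B * vnorm E x ^ n"
proof -
  obtain d where d: "0 < d" "\<And>y. y \<in> carrier E \<Longrightarrow> vnorm E (y \<ominus>\<^bsub>E\<^esub> \<zero>\<^bsub>E\<^esub>) < d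
      \<Longrightarrow> vnorm F (P y \<ominus>\<^bsub>F\<^esub> P \<zero>\<^bsub>E\<^esub>) < 1"
    using cpoly_continuous[OF P] zero_less_one unfolding continuous_map_on_def
    by (metis E.zero_closed)
  have small: "vnorm F (P y) < 1" if "y \<in> carrier E" "vnorm E y < d" for y
    using d(2)[OF that(1)] that P n by (simp add: cpoly_at_zero cpoly_closed)
  have "vnorm F (P x) \<le> (2 / d) ^ n * vnorm E x ^ n" if x: "x \<in> carrier E" for x
  proof (cases "vnorm E x = 0")
    case True
    then show ?thesis
      using x P n by (simp add: cpoly_at_zero power_0_left)
  next
    case False
    then have pos: "0 < vnorm E x"
      using x E.norm_nonneg[of x] by linarith
    define r where "r = d / (2 * vnorm E x)"
    have r: "0 < r"
      using pos d by (simp add: r_def)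
    have "vnorm E (of_real r \<odot>\<^bsub>E\<^esub> x) = r * vnorm E x"
      using x r by (simp add: E.norm_smult)
    also have "\<dots> < d"
      using pos d(1) by (simp add: r_def)
    finally have "vnorm E (of_real r \<odot>\<^bsub>E\<^esub> x) < d" .
    then have "vnorm F (P (of_real r \<odot>\<^bsub>E\<^esub> x)) < 1"
      using x by (intro small) auto
    then have "r ^ n * vnorm F (P x) < 1"
      using x r P by (simp add: cpoly_homogeneous[OF P] F.norm_smult norm_power cpoly_closed)
    then have "vnorm F (P x) \<le> 1 / r ^ n"
      using r by (simp add: field_simps)
    also have "1 / r ^ n = (2 / d) ^ n * vnorm E x ^ n"
      by (simp add: r_def power_divide power_mult_distrib)
    finally show ?thesis .
  qed
  then show ?thesis
    using d(1) by (intro exI[of _ "(2 / d) ^ n"]) auto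
qed

lemma poly_norm_bdd_above:
  assumes "P \<in> cpoly n E F" "1 \<le> n"
  shows "bdd_above ((\<lambda>x. vnorm F (P x)) ` {x \<in> carrier E. vnorm E x \<le> 1})"
proof -
  obtain B where B: "0 \<le> B" "\<And>x. x \<in> carrier E \<Longrightarrow> vnorm F (P x) \<le> B * vnorm E x ^ n"
    using cpoly_bounded[OF assms] by blast
  have "vnorm F (P x) \<le> B" if "x \<in> carrier E" "vnorm E x \<le> 1" for x
  proof -
    have "B * vnorm E x ^ n \<le> B * 1"
      using that B(1) by (intro mult_left_mono power_le_one) auto
    then show ?thesis
      using B(2)[OF that(1)] by linarith
  qed
  then show ?thesis
    by (intro bdd_aboveI[of _ B]) auto
qed

lemma poly_norm_nonneg:
  assumes "P \<in> cpoly n E F" "1 \<le> n"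
  shows "0 \<le> poly_norm E F P"
  unfolding poly_norm_def
  by (rule cSUP_upper2[OF poly_norm_bdd_above[OF assms], of "\<zero>\<^bsub>E\<^esub>"])
    (use assms in \<open>auto simp: cpoly_closed\<close>)

lemma cpoly_norm_le:
  assumes P: "P \<in> cpoly n E F" "1 \<le> n" and x: "x \<in> carrier E"
  shows "vnorm F (P x) \<le> poly_norm E F P * vnorm E x ^ n"
proof (cases "vnorm E x = 0")
  case True
  then show ?thesis
    using x P by (simp add: cpoly_at_zero power_0_left)
next
  case False
  then have pos: "0 < vnorm E x"
    using x E.norm_nonneg[of x] by linarith
  define r where "r = 1 / vnorm E x"
  have r: "0 < r"
    using pos by (simp add: r_def)
  let ?y = "of_real r \<odot>\<^bsub>E\<^esub> x"
  have "vnorm E ?y \<le> 1"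
    using x r by (simp add: E.norm_smult) (simp add: r_def)
  then have "vnorm F (P ?y) \<le> poly_norm E F P"
    unfolding poly_norm_def using x by (intro cSUP_upper[OF _ poly_norm_bdd_above[OF P]]) auto
  then have "r ^ n * vnorm F (P x) \<le> poly_norm E F P"
    using x r P by (simp add: cpoly_homogeneous[OF P(1)] F.norm_smult norm_power cpoly_closed)
  then show ?thesis
    using pos by (simp add: r_def power_divide field_simps)
qed

lemma poly_norm_le:
  assumes "\<And>x. x \<in> carrier E \<Longrightarrow> vnorm F (P x) \<le> B * vnorm E x ^ n" "0 \<le> B"
  shows "poly_norm E F P \<le> B"
  unfolding poly_norm_def
proof (rule cSUP_least)
  show "{x \<in> carrier E. vnorm E x \<le> 1} \<noteq> {}"
    using E.zero_closed E.norm_zero by fastforce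
  fix x
  assume x: "x \<in> {x \<in> carrier E. vnorm E x \<le> 1}"
  then have "B * vnorm E x ^ n \<le> B * 1"
    using assms(2) by (intro mult_left_mono power_le_one) auto
  then show "vnorm F (P x) \<le> B"
    using assms(1)[of x] x by simp
qed

lemma cpoly_zero: "(\<lambda>x\<in>carrier E. \<zero>\<^bsub>F\<^esub>) \<in> cpoly n E F"
proof (rule cpolyI[OF _ multilinear_map_zero])
  show "continuous_map_on E F (\<lambda>x\<in>carrier E. \<zero>\<^bsub>F\<^esub>)"
    unfolding continuous_map_on_def by (auto intro: exI[of _ 1])
qed auto

lemma cpoly_add:
  assumes P: "P \<in> cpoly n E F" and Q: "Q \<in> cpoly n E F"
  shows "(\<lambda>x\<in>carrier E. P x \<oplus>\<^bsub>F\<^esub> Q x) \<in> cpoly n E F"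
proof -
  obtain A where A: "multilinear_map n E F A" "\<And>x. x \<in> carrier E \<Longrightarrow> P x = A (\<lambda>i\<in>{..<n}. x)"
    using P by (rule cpoly_multilinear) blast
  obtain B where B: "multilinear_map n E F B" "\<And>x. x \<in> carrier E \<Longrightarrow> Q x = B (\<lambda>i\<in>{..<n}. x)"
    using Q by (rule cpoly_multilinear) blast
  have "continuous_map_on E F (\<lambda>x. P x \<oplus>\<^bsub>F\<^esub> Q x)"
    unfolding continuous_map_on_def
  proof (intro ballI allI impI)
    fix x and e :: real
    assume x: "x \<in> carrier E" and e: "0 < e"
    obtain c where c: "0 < c" "\<And>y. y \<in> carrier E \<Longrightarrow> vnorm E (y \<ominus>\<^bsub>E\<^esub> x) < c
        \<Longrightarrow> vnorm F (P y \<ominus>\<^bsub>F\<^esub> P x) < e / 2"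
      using cpoly_continuous[OF P] x half_gt_zero[OF e] unfolding continuous_map_on_def by metis
    obtain d where d: "0 < d" "\<And>y. y \<in> carrier E \<Longrightarrow> vnorm E (y \<ominus>\<^bsub>E\<^esub> x) < d
        \<Longrightarrow> vnorm F (Q y \<ominus>\<^bsub>F\<^esub> Q x) < e / 2"
      using cpoly_continuous[OF Q] x half_gt_zero[OF e] unfolding continuous_map_on_def by metis
    have "vnorm F ((P y \<oplus>\<^bsub>F\<^esub> Q y) \<ominus>\<^bsub>F\<^esub> (P x \<oplus>\<^bsub>F\<^esub> Q x)) < e"
      if y: "y \<in> carrier E" "vnorm E (y \<ominus>\<^bsub>E\<^esub> x) < min c d" for y
    proof -
      have "P x \<in> carrier F" "Q x \<in> carrier F" "P y \<in> carrier F" "Q y \<in> carrier F"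
        using P Q x y by auto
      then show ?thesis
        using F.norm_add_le[of "P y \<ominus>\<^bsub>F\<^esub> P x" "Q y \<ominus>\<^bsub>F\<^esub> Q x"] c(2)[OF y(1)] d(2)[OF y(1)] y(2)
        by (simp add: F.add_diff_add)
    qed
    then show "\<exists>d>0. \<forall>y\<in>carrier E. vnorm E (y \<ominus>\<^bsub>E\<^esub> x) < d \<longrightarrow>
        vnorm F ((P y \<oplus>\<^bsub>F\<^esub> Q y) \<ominus>\<^bsub>F\<^esub> (P x \<oplus>\<^bsub>F\<^esub> Q x)) < e"
      using c(1) d(1) by (intro exI[of _ "min c d"]) auto
  qed
  then have cont: "continuous_map_on E F (\<lambda>x\<in>carrier E. P x \<oplus>\<^bsub>F\<^esub> Q x)"
    by (rule continuous_map_on_cong) simp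
  show ?thesis
    by (rule cpolyI[OF _ multilinear_map_plus[OF A(1) B(1)] _ cont]) (simp_all add: A(2) B(2))
qed

lemma cpoly_smult:
  assumes P: "P \<in> cpoly n E F"
  shows "(\<lambda>x\<in>carrier E. a \<odot>\<^bsub>F\<^esub> P x) \<in> cpoly n E F"
proof -
  obtain A where A: "multilinear_map n E F A" "\<And>x. x \<in> carrier E \<Longrightarrow> P x = A (\<lambda>i\<in>{..<n}. x)"
    using P by (rule cpoly_multilinear) blast
  have "continuous_map_on E F (\<lambda>x. a \<odot>\<^bsub>F\<^esub> P x)"
    unfolding continuous_map_on_def
  proof (intro ballI allI impI)
    fix x and e :: real
    assume x: "x \<in> carrier E" and e: "0 < e"
    have pos: "0 < norm a + 1"
      by (simp add: add_nonneg_pos)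
    then have "0 < e / (norm a + 1)"
      using e by simp
    then obtain d where d: "0 < d" "\<And>y. y \<in> carrier E \<Longrightarrow> vnorm E (y \<ominus>\<^bsub>E\<^esub> x) < d
        \<Longrightarrow> vnorm F (P y \<ominus>\<^bsub>F\<^esub> P x) < e / (norm a + 1)"
      using cpoly_continuous[OF P] x unfolding continuous_map_on_def by metis
    have "vnorm F ((a \<odot>\<^bsub>F\<^esub> P y) \<ominus>\<^bsub>F\<^esub> (a \<odot>\<^bsub>F\<^esub> P x)) < e"
      if y: "y \<in> carrier E" "vnorm E (y \<ominus>\<^bsub>E\<^esub> x) < d" for y
    proof -
      have cl: "P x \<in> carrier F" "P y \<in> carrier F"
        using P x y by auto
      have "norm a * vnorm F (P y \<ominus>\<^bsub>F\<^esub> P x) \<le> norm a * (e / (norm a + 1))"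
        using d(2)[OF y] by (intro mult_left_mono) auto
      also have "\<dots> < e"
        using e pos by (simp add: field_simps)
      finally show ?thesis
        using cl by (simp add: F.norm_smult flip: F.smult_diff)
    qed
    then show "\<exists>d>0. \<forall>y\<in>carrier E. vnorm E (y \<ominus>\<^bsub>E\<^esub> x) < d \<longrightarrow>
        vnorm F ((a \<odot>\<^bsub>F\<^esub> P y) \<ominus>\<^bsub>F\<^esub> (a \<odot>\<^bsub>F\<^esub> P x)) < e"
      using d(1) by blast
  qed
  then have cont: "continuous_map_on E F (\<lambda>x\<in>carrier E. a \<odot>\<^bsub>F\<^esub> P x)"
    by (rule continuous_map_on_cong) simp
  show ?thesis
    by (rule cpolyI[OF _ multilinear_map_scale[OF A(1)] _ cont]) (simp_all add: A(2))
qed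

text \<open>The multilinear map comes from \<open>multilinear_diagonal_limit\<close>; continuity is the usual
  argument for a limit that is uniform on balls.\<close>

lemma cpoly_limit:
  fixes P :: "nat \<Rightarrow> 'v \<Rightarrow> 'w"
  assumes P: "\<And>j. P j \<in> cpoly n E F" and Q: "Q \<in> carrier E \<rightarrow>\<^sub>E carrier F"
    and unif: "\<And>e. 0 < e \<Longrightarrow>
      \<exists>M. \<forall>j\<ge>M. \<forall>x\<in>carrier E. vnorm F (P j x \<ominus>\<^bsub>F\<^esub> Q x) \<le> e * vnorm E x ^ n"
  shows "Q \<in> cpoly n E F"
proof -
  have lim: "F.tends_to (\<lambda>j. P j x) (Q x)" if x: "x \<in> carrier E" for x
  proof -
    have "(\<lambda>j. vnorm F (P j x \<ominus>\<^bsub>F\<^esub> Q x)) \<longlonglongrightarrow> 0"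
    proof (rule LIMSEQ_I)
      fix r :: real
      assume r: "0 < r"
      have pos: "0 < vnorm E x ^ n + 1"
        using x by (simp add: add_nonneg_pos)
      then obtain M where M: "\<And>j. j \<ge> M \<Longrightarrow> vnorm F (P j x \<ominus>\<^bsub>F\<^esub> Q x) \<le> r / (vnorm E x ^ n + 1) * vnorm E x ^ n"
        using unif[of "r / (vnorm E x ^ n + 1)"] r x by auto
      have "r / (vnorm E x ^ n + 1) * vnorm E x ^ n < r"
        using r pos by (simp add: field_simps)
      moreover have "0 \<le> vnorm F (P j x \<ominus>\<^bsub>F\<^esub> Q x)" for j
        using P Q x by (intro F.norm_nonneg F.minus_closed) auto
      ultimately have "norm (vnorm F (P j x \<ominus>\<^bsub>F\<^esub> Q x) - 0) < r" if "j \<ge> M" for j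
        using M[OF that] by (simp add: abs_of_nonneg)
      then show "\<exists>M. \<forall>j\<ge>M. norm (vnorm F (P j x \<ominus>\<^bsub>F\<^esub> Q x) - 0) < r"
        by blast
    qed
    then show ?thesis
      using P Q x by (auto simp: F.tends_to_def)
  qed
  have "\<forall>j. \<exists>A. multilinear_map n E F A \<and> (\<forall>x\<in>carrier E. P j x = A (\<lambda>i\<in>{..<n}. x))"
    using P by (simp add: cpoly_def)
  then obtain A where A: "\<And>j. multilinear_map n E F (A j)"
      "\<And>j x. x \<in> carrier E \<Longrightarrow> P j x = A j (\<lambda>i\<in>{..<n}. x)"
    unfolding choice_iff by blast
  obtain L where L: "multilinear_map n E F L" "\<And>x. x \<in> carrier E \<Longrightarrow> Q x = L (\<lambda>i\<in>{..<n}. x)"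
    using multilinear_diagonal_limit[of n A Q] A lim by auto
  have "continuous_map_on E F Q"
    unfolding continuous_map_on_def
  proof (intro ballI allI impI)
    fix x and e :: real
    assume x: "x \<in> carrier E" and e: "0 < e"
    define R where "R = (vnorm E x + 1) ^ n"
    have R: "0 < R"
      using x by (simp add: R_def add_nonneg_pos)
    obtain j where j: "\<And>y. y \<in> carrier E \<Longrightarrow> vnorm F (P j y \<ominus>\<^bsub>F\<^esub> Q y) \<le> e / (3 * R) * vnorm E y ^ n"
      using unif[of "e / (3 * R)"] e R by auto
    have close: "vnorm F (P j y \<ominus>\<^bsub>F\<^esub> Q y) \<le> e / 3" if "y \<in> carrier E" "vnorm E y \<le> vnorm E x + 1" for y
    proof -
      have "e / (3 * R) * vnorm E y ^ n \<le> e / (3 * R) * R"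
        unfolding R_def using that e R by (intro mult_left_mono power_mono) (auto simp: R_def)
      also have "e / (3 * R) * R = e / 3"
        using R by simp
      finally show ?thesis
        using j[OF that(1)] by linarith
    qed
    have "0 < e / 3"
      using e by simp
    then obtain d where d: "0 < d" "\<And>y. y \<in> carrier E \<Longrightarrow> vnorm E (y \<ominus>\<^bsub>E\<^esub> x) < d
        \<Longrightarrow> vnorm F (P j y \<ominus>\<^bsub>F\<^esub> P j x) < e / 3"
      using cpoly_continuous[OF P, of j] x unfolding continuous_map_on_def by metis
    have "vnorm F (Q y \<ominus>\<^bsub>F\<^esub> Q x) < e"
      if y: "y \<in> carrier E" "vnorm E (y \<ominus>\<^bsub>E\<^esub> x) < min 1 d" for y
    proof -
      have cl: "Q x \<in> carrier F" "Q y \<in> carrier F" "P j x \<in> carrier F" "P j y \<in> carrier F"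
        using P Q x y by auto
      have "vnorm E y \<le> vnorm E x + 1"
        using E.norm_le_norm_diff[OF y(1) x] y(2) by simp
      then have "vnorm F (Q y \<ominus>\<^bsub>F\<^esub> P j y) \<le> e / 3" "vnorm F (P j x \<ominus>\<^bsub>F\<^esub> Q x) \<le> e / 3"
        using close[of y] close[of x] x y cl by (simp_all add: F.norm_diff_commute)
      moreover have "vnorm F (P j y \<ominus>\<^bsub>F\<^esub> P j x) < e / 3"
        using d(2)[OF y(1)] y(2) by simp
      moreover have "vnorm F (Q y \<ominus>\<^bsub>F\<^esub> Q x) \<le> vnorm F (Q y \<ominus>\<^bsub>F\<^esub> P j y) +
          (vnorm F (P j y \<ominus>\<^bsub>F\<^esub> P j x) + vnorm F (P j x \<ominus>\<^bsub>F\<^esub> Q x))"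
        using F.norm_diff_triangle[of "Q y" "P j y" "Q x"] F.norm_diff_triangle[of "P j y" "P j x" "Q x"] cl
        by linarith
      ultimately show ?thesis
        by linarith
    qed
    then show "\<exists>d>0. \<forall>y\<in>carrier E. vnorm E (y \<ominus>\<^bsub>E\<^esub> x) < d \<longrightarrow> vnorm F (Q y \<ominus>\<^bsub>F\<^esub> Q x) < e"
      using d(1) by (intro exI[of _ "min 1 d"]) auto
  qed
  then show ?thesis
    using Q L by (intro cpolyI) (auto simp: PiE_iff)
qed

lemma linear_space_cpoly_module: "linear_space (cpoly_module n E F)"
proof (rule linear_spaceI, unfold cpoly_module_def partial_object.simps ring.simps module.simps)
  show "(\<lambda>x\<in>carrier E. \<zero>\<^bsub>F\<^esub>) \<in> cpoly n E F"
    by (rule cpoly_zero)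
next
  fix P Q R a b
  assume P: "P \<in> cpoly n E F"
  have ext: "P' = P" if "P' \<in> extensional (carrier E)" "\<And>x. x \<in> carrier E \<Longrightarrow> P' x = P x" for P'
    using extensionalityI[OF that(1) cpoly_extensional[OF P] that(2)] .
  show "(\<lambda>x\<in>carrier E. a \<odot>\<^bsub>F\<^esub> P x) \<in> cpoly n E F"
    using P by (rule cpoly_smult)
  show "(\<lambda>x\<in>carrier E. (\<lambda>x\<in>carrier E. \<zero>\<^bsub>F\<^esub>) x \<oplus>\<^bsub>F\<^esub> P x) = P"
    using P by (intro ext) auto
  show "(\<lambda>x\<in>carrier E. (\<lambda>x\<in>carrier E. (- 1) \<odot>\<^bsub>F\<^esub> P x) x \<oplus>\<^bsub>F\<^esub> P x) = (\<lambda>x\<in>carrier E. \<zero>\<^bsub>F\<^esub>)"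
    using P by (intro restrict_ext) (simp add: F.l_neg cpoly_closed flip: F.minus_conv_smult)
  show "(\<lambda>x\<in>carrier E. (a + b) \<odot>\<^bsub>F\<^esub> P x) =
      (\<lambda>x\<in>carrier E. (\<lambda>x\<in>carrier E. a \<odot>\<^bsub>F\<^esub> P x) x \<oplus>\<^bsub>F\<^esub> (\<lambda>x\<in>carrier E. b \<odot>\<^bsub>F\<^esub> P x) x)"
    using P by (intro restrict_ext) (simp add: F.smult_add_left cpoly_closed)
  show "(\<lambda>x\<in>carrier E. (a * b) \<odot>\<^bsub>F\<^esub> P x) = (\<lambda>x\<in>carrier E. a \<odot>\<^bsub>F\<^esub> (\<lambda>x\<in>carrier E. b \<odot>\<^bsub>F\<^esub> P x) x)"
    using P by (intro restrict_ext) (simp add: F.smult_assoc cpoly_closed)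
  show "(\<lambda>x\<in>carrier E. 1 \<odot>\<^bsub>F\<^esub> P x) = P"
    using P by (intro ext) auto
  assume Q: "Q \<in> cpoly n E F"
  show "(\<lambda>x\<in>carrier E. P x \<oplus>\<^bsub>F\<^esub> Q x) \<in> cpoly n E F"
    using P Q by (rule cpoly_add)
  show "(\<lambda>x\<in>carrier E. P x \<oplus>\<^bsub>F\<^esub> Q x) = (\<lambda>x\<in>carrier E. Q x \<oplus>\<^bsub>F\<^esub> P x)"
    using P Q by (intro restrict_ext) (simp add: F.a_comm cpoly_closed)
  show "(\<lambda>x\<in>carrier E. a \<odot>\<^bsub>F\<^esub> (\<lambda>x\<in>carrier E. P x \<oplus>\<^bsub>F\<^esub> Q x) x) =
      (\<lambda>x\<in>carrier E. (\<lambda>x\<in>carrier E. a \<odot>\<^bsub>F\<^esub> P x) x \<oplus>\<^bsub>F\<^esub> (\<lambda>x\<in>carrier E. a \<odot>\<^bsub>F\<^esub> Q x) x)"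
    using P Q by (intro restrict_ext) (simp add: F.smult_add_right cpoly_closed)
  assume R: "R \<in> cpoly n E F"
  show "(\<lambda>x\<in>carrier E. (\<lambda>x\<in>carrier E. P x \<oplus>\<^bsub>F\<^esub> Q x) x \<oplus>\<^bsub>F\<^esub> R x) =
      (\<lambda>x\<in>carrier E. P x \<oplus>\<^bsub>F\<^esub> (\<lambda>x\<in>carrier E. Q x \<oplus>\<^bsub>F\<^esub> R x) x)"
    using P Q R by (intro restrict_ext) (simp add: F.a_assoc cpoly_closed)
qed

end

subsection \<open>Composition\<close>

lemma block_index_less:
  assumes "i < n" "j < (m::nat)"
  shows "i * m + j < m * n"
proof -
  have "i * m + j < Suc i * m"
    using assms by simp
  also have "\<dots> \<le> n * m"
    using assms by (intro mult_le_mono1) simp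
  finally show ?thesis
    by (simp add: mult.commute)
qed

text \<open>The \<open>m n\<close> arguments are split into \<open>n\<close> consecutive blocks of length \<open>m\<close>: the argument
  with number \<open>l\<close> stands at place \<open>l mod m\<close> of block \<open>l div m\<close>.\<close>

lemma multilinear_map_compose:
  fixes G :: "('k, 'c) nspace"
  assumes A: "multilinear_map n E F A" and B: "multilinear_map m G E B"
  shows "multilinear_map (m * n) G F (\<lambda>x. A (\<lambda>i\<in>{..<n}. B (\<lambda>j\<in>{..<m}. x (i * m + j))))"
proof -
  let ?b = "\<lambda>x i. \<lambda>j\<in>{..<m}. x (i * m + j)"
  have b: "?b x i \<in> {..<m} \<rightarrow>\<^sub>E carrier G" if "x \<in> {..<m * n} \<rightarrow>\<^sub>E carrier G" "i < n" for x i
    using that block_index_less by (auto simp: PiE_iff)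
  have Bb: "B (?b x i) \<in> carrier E" if "x \<in> {..<m * n} \<rightarrow>\<^sub>E carrier G" "i < n" for x i
    by (rule multilinear_map_closed[OF B b[OF that]])
  have outer: "(\<lambda>i\<in>{..<n}. B (?b x i)) \<in> {..<n} \<rightarrow>\<^sub>E carrier E" if "x \<in> {..<m * n} \<rightarrow>\<^sub>E carrier G" for x
    using Bb[OF that] by auto
  have div_mod: "l div m < n" "l mod m < m" if "l < m * n" for l
    using that by (auto simp: less_mult_imp_div_less mult.commute intro!: mod_less_divisor gr0I)
  \<comment> \<open>Changing one argument changes exactly one place of one block.\<close>
  have upd: "(\<lambda>i\<in>{..<n}. B (?b (x(l := y)) i)) =
      (\<lambda>i\<in>{..<n}. B (?b x i))(l div m := B ((?b x (l div m))(l mod m := y)))"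
    if l: "l < m * n" for x l y
  proof
    fix i
    have "?b (x(l := y)) i = (if i = l div m then (?b x i)(l mod m := y) else ?b x i)" if "i < n"
    proof
      fix j
      have "i * m + j = l \<longleftrightarrow> i = l div m \<and> j = l mod m" if "j < m"
        using that by auto
      then show "?b (x(l := y)) i j = (if i = l div m then (?b x i)(l mod m := y) else ?b x i) j"
        using div_mod[OF l] by auto
    qed
    then show "(\<lambda>i\<in>{..<n}. B (?b (x(l := y)) i)) i =
        ((\<lambda>i\<in>{..<n}. B (?b x i))(l div m := B ((?b x (l div m))(l mod m := y)))) i"
      using div_mod[OF l] by (cases "i < n") auto
  qed
  show ?thesis
  proof (rule multilinear_mapI)
    fix x :: "nat \<Rightarrow> 'c" and l y z
    assume x: "x \<in> {..<m * n} \<rightarrow>\<^sub>E carrier G" and l: "l < m * n" and yz: "y \<in> carrier G" "z \<in> carrier G"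
    note dm = div_mod[OF l]
    show "A (\<lambda>i\<in>{..<n}. B (?b (x(l := y \<oplus>\<^bsub>G\<^esub> z)) i)) =
        A (\<lambda>i\<in>{..<n}. B (?b (x(l := y)) i)) \<oplus>\<^bsub>F\<^esub> A (\<lambda>i\<in>{..<n}. B (?b (x(l := z)) i))"
      unfolding upd[OF l] multilinear_map_add[OF B b[OF x dm(1)] dm(2) yz]
      by (intro multilinear_map_add[OF A outer[OF x] dm(1)]
          multilinear_map_upd_closed[OF B b[OF x dm(1)] dm(2)] yz)
  next
    fix x :: "nat \<Rightarrow> 'c" and l a y
    assume x: "x \<in> {..<m * n} \<rightarrow>\<^sub>E carrier G" and l: "l < m * n" and y: "y \<in> carrier G"
    note dm = div_mod[OF l]
    show "A (\<lambda>i\<in>{..<n}. B (?b (x(l := a \<odot>\<^bsub>G\<^esub> y)) i)) =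
        a \<odot>\<^bsub>F\<^esub> A (\<lambda>i\<in>{..<n}. B (?b (x(l := y)) i))"
      unfolding upd[OF l] multilinear_map_smult[OF B b[OF x dm(1)] dm(2) y]
      by (intro multilinear_map_smult[OF A outer[OF x] dm(1)]
          multilinear_map_upd_closed[OF B b[OF x dm(1)] dm(2)] y)
  qed (rule multilinear_map_closed[OF A outer])
qed

lemma cpoly_compose:
  assumes P: "P \<in> cpoly n E F" and R: "R \<in> cpoly m G E"
  shows "(\<lambda>x\<in>carrier G. P (R x)) \<in> cpoly (m * n) G F"
proof -
  obtain A where A: "multilinear_map n E F A" "\<And>x. x \<in> carrier E \<Longrightarrow> P x = A (\<lambda>i\<in>{..<n}. x)"
    using P by (rule cpoly_multilinear) blast
  obtain B where B: "multilinear_map m G E B" "\<And>x. x \<in> carrier G \<Longrightarrow> R x = B (\<lambda>i\<in>{..<m}. x)"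
    using R by (rule cpoly_multilinear) blast
  have "continuous_map_on G F (\<lambda>x. P (R x))"
    by (rule continuous_map_on_compose[OF cpoly_continuous[OF R] cpoly_continuous[OF P] cpoly_closed[OF R]])
  then have cont: "continuous_map_on G F (\<lambda>x\<in>carrier G. P (R x))"
    by (rule continuous_map_on_cong) simp
  show ?thesis
  proof (rule cpolyI[OF _ multilinear_map_compose[OF A(1) B(1)] _ cont])
    fix x
    assume x: "x \<in> carrier G"
    have "(\<lambda>i\<in>{..<n}. B (\<lambda>j\<in>{..<m}. (\<lambda>l\<in>{..<m * n}. x) (i * m + j))) = (\<lambda>i\<in>{..<n}. B (\<lambda>j\<in>{..<m}. x))"
      using block_index_less by (intro restrict_ext arg_cong[where f = B]) auto
    then show "(\<lambda>x\<in>carrier G. P (R x)) x =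
        A (\<lambda>i\<in>{..<n}. B (\<lambda>j\<in>{..<m}. (\<lambda>l\<in>{..<m * n}. x) (i * m + j)))"
      using A(2)[OF cpoly_closed[OF R x]] by (simp only: restrict_apply'[OF x] B(2)[OF x])
  qed simp
qed

lemma poly_norm_compose_le:
  assumes "banach_space E" "banach_space F" "banach_space G"
    and P: "P \<in> cpoly n E F" "1 \<le> n" and R: "R \<in> cpoly m G E" "1 \<le> m"
  shows "poly_norm G F (\<lambda>x\<in>carrier G. P (R x)) \<le> poly_norm E F P * poly_norm G E R ^ n"
proof -
  interpret EF: normed_pair E F
    using assms by (intro normed_pair.intro normed_spaceI)
  interpret GE: normed_pair G E
    using assms by (intro normed_pair.intro normed_spaceI)
  interpret GF: normed_pair G F
    using assms by (intro normed_pair.intro normed_spaceI)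
  note nonneg = EF.poly_norm_nonneg[OF P] GE.poly_norm_nonneg[OF R]
  show ?thesis
  proof (rule GF.poly_norm_le[where n = "m * n"])
    fix x
    assume x: "x \<in> carrier G"
    have "vnorm F (P (R x)) \<le> poly_norm E F P * vnorm E (R x) ^ n"
      using R x by (intro EF.cpoly_norm_le[OF P]) auto
    also have "\<dots> \<le> poly_norm E F P * (poly_norm G E R * vnorm G x ^ m) ^ n"
      using R x nonneg by (intro mult_left_mono power_mono GE.cpoly_norm_le[OF R]) auto
    finally show "vnorm F ((\<lambda>x\<in>carrier G. P (R x)) x) \<le>
        poly_norm E F P * poly_norm G E R ^ n * vnorm G x ^ (m * n)"
      using x by (simp add: power_mult_distrib power_mult mult.assoc)
  qed (use nonneg in simp)
qed


section \<open>The scalar field as a Banach space\<close>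

lemma scalar_space_simps [simp]:
  "carrier scalar_space = range Inl" "\<zero>\<^bsub>scalar_space\<^esub> = Inl 0"
  "x \<oplus>\<^bsub>scalar_space\<^esub> y = Inl (projl x + projl y)" "a \<odot>\<^bsub>scalar_space\<^esub> x = Inl (a * projl x)"
  "vnorm scalar_space x = norm (projl x)"
  by (simp_all add: scalar_space_def)

lemma linear_space_scalar_space:
  "linear_space (scalar_space :: ('k::real_normed_field, 'k + 'u) nspace)"
  by (rule linear_spaceI) (auto simp: algebra_simps)

lemma scalar_space_diff:
  "Inl a \<ominus>\<^bsub>scalar_space :: ('k::real_normed_field, 'k + 'u) nspace\<^esub> Inl b = Inl (a - b)"
  by (simp add: linear_space.diff_conv_smult[OF linear_space_scalar_space])

lemma banach_space_scalar_space:
  "banach_space (scalar_space :: ('k::{real_normed_field, banach}, 'k + 'u) nspace)" (is "banach_space ?K")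
proof -
  have "p_norm_on 1 ?K (vnorm ?K)"
    by (auto simp: p_norm_on_def norm_mult norm_triangle_ineq)
  moreover have "complete_on ?K (vnorm ?K)"
    unfolding complete_on_def
  proof (intro allI impI, elim conjE)
    fix s :: "nat \<Rightarrow> 'k + 'u"
    assume "\<forall>i. s i \<in> carrier ?K"
      and Cauchy: "\<forall>e>0. \<exists>M. \<forall>i\<ge>M. \<forall>j\<ge>M. vnorm ?K (s i \<ominus>\<^bsub>?K\<^esub> s j) < e"
    then have s: "s i = Inl (projl (s i))" for i
      by (metis imageE scalar_space_simps(1) sum.sel(1))
    have diff: "vnorm ?K (s i \<ominus>\<^bsub>?K\<^esub> Inl a) = norm (projl (s i) - a)" for i a
      by (subst s) (simp add: scalar_space_diff)
    have "vnorm ?K (s i \<ominus>\<^bsub>?K\<^esub> s j) = norm (projl (s i) - projl (s j))" for i j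
      by (subst (2) s) (rule diff)
    then have "Cauchy (\<lambda>i. projl (s i))"
      using Cauchy by (simp add: Cauchy_def dist_norm)
    then obtain l where l: "(\<lambda>i. projl (s i)) \<longlonglongrightarrow> l"
      using Cauchy_convergent convergent_def by blast
    have "(\<lambda>i. vnorm ?K (s i \<ominus>\<^bsub>?K\<^esub> Inl l)) \<longlonglongrightarrow> 0"
      unfolding diff using l by (intro tendsto_norm_zero LIM_zero)
    then show "\<exists>l\<in>carrier ?K. (\<lambda>i. vnorm ?K (s i \<ominus>\<^bsub>?K\<^esub> l)) \<longlonglongrightarrow> 0"
      by auto
  qed
  ultimately show ?thesis
    using linear_space.module_V[OF linear_space_scalar_space]
    by (simp add: banach_space_def p_banach_def)
qed

definition scalar_power :: "nat \<Rightarrow> 'k::real_normed_field + 'u \<Rightarrow> 'k + 'u" where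
  "scalar_power n = (\<lambda>x\<in>range Inl. Inl (projl x ^ n))"

lemma scalar_power_cpoly:
  "scalar_power n \<in> cpoly n (scalar_space :: ('k::real_normed_field, 'k + 'u) nspace) scalar_space"
    (is "_ \<in> cpoly n ?K ?K")
proof (rule cpolyI)
  show "multilinear_map n ?K ?K (\<lambda>x. Inl (\<Prod>i<n. projl (x i)))"
  proof (rule multilinear_mapI)
    have upd: "(\<Prod>j<n. projl ((x(i := y)) j)) = projl y * (\<Prod>j\<in>{..<n} - {i}. projl (x j))"
      if "i < n" for x :: "nat \<Rightarrow> 'k + 'u" and i y
      using that by (simp add: prod.remove[of "{..<n}" i])
    fix x :: "nat \<Rightarrow> 'k + 'u" and i y z a
    assume "i < n"
    then show "Inl (\<Prod>j<n. projl ((x(i := y \<oplus>\<^bsub>?K\<^esub> z)) j)) =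
        Inl (\<Prod>j<n. projl ((x(i := y)) j)) \<oplus>\<^bsub>?K\<^esub> Inl (\<Prod>j<n. projl ((x(i := z)) j))"
      "Inl (\<Prod>j<n. projl ((x(i := a \<odot>\<^bsub>?K\<^esub> y)) j)) = a \<odot>\<^bsub>?K\<^esub> Inl (\<Prod>j<n. projl ((x(i := y)) j))"
      by (simp_all only: upd scalar_space_simps sum.sel) (simp_all add: ring_distribs mult.assoc)
  qed simp
  show "continuous_map_on ?K ?K (scalar_power n)"
    unfolding continuous_map_on_def
  proof (intro ballI allI impI)
    fix x :: "'k + 'u" and e :: real
    assume "x \<in> carrier ?K" and e: "0 < e"
    then obtain a where x: "x = Inl a"
      by auto
    have "(\<lambda>z. z ^ n) \<midarrow>a\<rightarrow> a ^ n"
      by (intro tendsto_intros)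
    then obtain d where d: "0 < d" "\<And>z. z \<noteq> a \<Longrightarrow> norm (z - a) < d \<Longrightarrow> norm (z ^ n - a ^ n) < e"
      using e unfolding LIM_eq by blast
    have "vnorm ?K (scalar_power n y \<ominus>\<^bsub>?K\<^esub> scalar_power n x) < e"
      if near: "y \<in> carrier ?K" "vnorm ?K (y \<ominus>\<^bsub>?K\<^esub> x) < d" for y
    proof -
      obtain b where y: "y = Inl b"
        using near(1) by auto
      show ?thesis
        using near(2) d(2)[of b] e by (cases "b = a") (auto simp: x y scalar_power_def scalar_space_diff)
    qed
    then show "\<exists>d>0. \<forall>y\<in>carrier ?K. vnorm ?K (y \<ominus>\<^bsub>?K\<^esub> x) < d \<longrightarrow>
        vnorm ?K (scalar_power n y \<ominus>\<^bsub>?K\<^esub> scalar_power n x) < e"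
      using d(1) by blast
  qed
qed (auto simp: scalar_power_def)

lemma poly_norm_scalar_power_le:
  "poly_norm (scalar_space :: ('k::{real_normed_field, banach}, 'k + 'u) nspace) scalar_space (scalar_power n) \<le> 1"
proof -
  interpret normed_pair "scalar_space :: ('k, 'k + 'u) nspace" "scalar_space :: ('k, 'k + 'u) nspace"
    by (intro normed_pair.intro normed_spaceI banach_space_scalar_space)
  show ?thesis
    by (rule poly_norm_le[where n = n]) (auto simp: scalar_power_def norm_power)
qed

definition line_map :: "('k::real_normed_field, 'v) nspace \<Rightarrow> 'v \<Rightarrow> 'k + 'u \<Rightarrow> 'v" where
  "line_map F y = (\<lambda>z\<in>range Inl. projl z \<odot>\<^bsub>F\<^esub> y)"

context normed_space
begin

lemma line_map_cpoly:
  assumes y: "y \<in> carrier E"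
  shows "line_map E y \<in> cpoly 1 (scalar_space :: ('k, 'k + 'u) nspace) E" (is "_ \<in> cpoly 1 ?K E")
proof (rule cpolyI)
  show "multilinear_map 1 ?K E (\<lambda>x. projl (x 0) \<odot> y)"
    using y by (intro multilinear_mapI) (auto simp: smult_add_left smult_assoc)
  show "continuous_map_on ?K E (line_map E y)"
    unfolding continuous_map_on_def
  proof (intro ballI allI impI)
    fix x :: "'k + 'u" and e :: real
    assume "x \<in> carrier ?K" and e: "0 < e"
    then obtain a where x: "x = Inl a"
      by auto
    define d where "d = e / (vnorm E y + 1)"
    have pos: "0 < vnorm E y + 1"
      using y by (simp add: add_nonneg_pos)
    have d: "0 < d"
      using e pos by (simp add: d_def)
    have "vnorm E (line_map E y z \<ominus> line_map E y x) < e"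
      if near: "z \<in> carrier ?K" "vnorm ?K (z \<ominus>\<^bsub>?K\<^esub> x) < d" for z
    proof -
      obtain b where z: "z = Inl b"
        using near(1) by auto
      have "norm (b - a) * vnorm E y \<le> d * vnorm E y"
        using near(2) y by (intro mult_right_mono) (auto simp: x z scalar_space_diff)
      also have "\<dots> < e"
        using e pos by (simp add: d_def field_simps)
      finally show ?thesis
        using y by (simp add: x z line_map_def norm_smult flip: diff_smult)
    qed
    then show "\<exists>d>0. \<forall>z\<in>carrier ?K. vnorm ?K (z \<ominus>\<^bsub>?K\<^esub> x) < d \<longrightarrow>
        vnorm E (line_map E y z \<ominus> line_map E y x) < e"
      using d by blast
  qed
qed (auto simp: line_map_def)

end


section \<open>Sequence functors\<close>

locale sequence_functor =
  fixes X :: "('k::{real_normed_field, banach}, 'u) seq_corr" and p :: real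
  assumes p_pos: "0 < p" and seq_fun: "seq_functor p X"
begin

lemma p_normed:
  assumes "banach_space E"
  shows "p_norm_on p ((seq_module E)\<lparr>carrier := fst (X E)\<rparr>) (snd (X E))"
  using seq_fun assms by (simp add: seq_functor_def p_banach_def)

lemma submod:
  assumes "banach_space E"
  shows "submodule (fst (X E)) scalar_ring (seq_module E)"
  using seq_fun assms by (simp add: seq_functor_def)

lemma single_seq:
  assumes "banach_space E" "x \<in> carrier E"
  shows "single_seq E j x \<in> fst (X E)" "snd (X E) (single_seq E j x) = vnorm E x"
  using seq_fun assms by (simp_all add: seq_functor_def)

lemma seq_add_closed:
  assumes "banach_space E" "x \<in> fst (X E)" "y \<in> fst (X E)"
  shows "(\<lambda>j. x j \<oplus>\<^bsub>E\<^esub> y j) \<in> fst (X E)"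
proof -
  have "subgroup (fst (X E)) (add_monoid (seq_module E))"
    using submod[OF assms(1)] by (rule submodule.axioms)
  from subgroup.m_closed[OF this assms(2,3)] show ?thesis
    by (simp add: seq_module_def)
qed

lemma seq_norm_nonneg:
  "banach_space E \<Longrightarrow> x \<in> fst (X E) \<Longrightarrow> 0 \<le> snd (X E) x"
  using p_normed by (simp add: p_norm_on_def)

lemma seq_norm_smult:
  "banach_space E \<Longrightarrow> x \<in> fst (X E) \<Longrightarrow> snd (X E) (\<lambda>j. a \<odot>\<^bsub>E\<^esub> x j) = norm a * snd (X E) x"
  using p_normed by (simp add: p_norm_on_def seq_module_def)

lemma seq_norm_add:
  "banach_space E \<Longrightarrow> x \<in> fst (X E) \<Longrightarrow> y \<in> fst (X E) \<Longrightarrow>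
    snd (X E) (\<lambda>j. x j \<oplus>\<^bsub>E\<^esub> y j) powr p \<le> snd (X E) x powr p + snd (X E) y powr p"
  using p_normed by (simp add: p_norm_on_def seq_module_def)

lemma seq_norm_zero:
  assumes "banach_space E"
  shows "(\<lambda>j. \<zero>\<^bsub>E\<^esub>) \<in> fst (X E)" "snd (X E) (\<lambda>j. \<zero>\<^bsub>E\<^esub>) = 0"
proof -
  interpret normed_space E
    using assms by (rule normed_spaceI)
  show "(\<lambda>j. \<zero>\<^bsub>E\<^esub>) \<in> fst (X E)" "snd (X E) (\<lambda>j. \<zero>\<^bsub>E\<^esub>) = 0"
    using single_seq[OF assms zero_closed, of 0] by (simp_all add: single_seq_def cong: if_cong)
qed

text \<open>A finite sequence is the sum of its coordinates, each of which lies in \<open>X E\<close> with the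
  norm of \<open>E\<close>.\<close>

lemma fin_seq_norm:
  assumes E: "banach_space E" and x: "x \<in> {..<k} \<rightarrow> carrier E"
  shows "fin_seq E k x \<in> fst (X E) \<and> snd (X E) (fin_seq E k x) powr p \<le> (\<Sum>j<k. vnorm E (x j) powr p)"
  using x
proof (induction k)
  case 0
  have "fin_seq E 0 x = (\<lambda>j. \<zero>\<^bsub>E\<^esub>)"
    by (simp add: fin_seq_def)
  then show ?case
    using seq_norm_zero[OF E] p_pos by simp
next
  case (Suc k)
  interpret normed_space E
    using E by (rule normed_spaceI)
  have x: "x \<in> {..<k} \<rightarrow> carrier E" "x k \<in> carrier E"
    using Suc.prems by auto
  have xj: "x j \<in> carrier E" if "j < k" for j
    using x(1) that by auto
  have "fin_seq E (Suc k) x = (\<lambda>j. fin_seq E k x j \<oplus>\<^bsub>E\<^esub> single_seq E k (x k) j)"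
    using x(2) xj by (auto simp: fin_seq_def single_seq_def fun_eq_iff less_Suc_eq)
  then show ?case
    using Suc.IH[OF x(1)] single_seq[OF E x(2), of k]
      seq_add_closed[OF E, of "fin_seq E k x" "single_seq E k (x k)"]
      seq_norm_add[OF E, of "fin_seq E k x" "single_seq E k (x k)"] by simp
qed

lemma fin_seq_closed: "banach_space E \<Longrightarrow> x \<in> {..<k} \<rightarrow> carrier E \<Longrightarrow> fin_seq E k x \<in> fst (X E)"
  using fin_seq_norm by blast

lemma fin_seq_nonneg:
  "banach_space E \<Longrightarrow> x \<in> {..<k} \<rightarrow> carrier E \<Longrightarrow> 0 \<le> snd (X E) (fin_seq E k x)"
  by (intro seq_norm_nonneg fin_seq_closed)

lemma fin_seq_add:
  assumes E: "banach_space E" and "x \<in> {..<k} \<rightarrow> carrier E" "y \<in> {..<k} \<rightarrow> carrier E"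
  shows "snd (X E) (fin_seq E k (\<lambda>j. x j \<oplus>\<^bsub>E\<^esub> y j)) powr p
    \<le> snd (X E) (fin_seq E k x) powr p + snd (X E) (fin_seq E k y) powr p"
proof -
  interpret normed_space E
    using E by (rule normed_spaceI)
  have "fin_seq E k (\<lambda>j. x j \<oplus>\<^bsub>E\<^esub> y j) = (\<lambda>j. fin_seq E k x j \<oplus>\<^bsub>E\<^esub> fin_seq E k y j)"
    by (auto simp: fin_seq_def)
  then show ?thesis
    using seq_norm_add[OF E fin_seq_closed[OF assms(1,2)] fin_seq_closed[OF assms(1,3)]] by simp
qed

lemma fin_seq_smult:
  assumes E: "banach_space E" and "x \<in> {..<k} \<rightarrow> carrier E"
  shows "snd (X E) (fin_seq E k (\<lambda>j. a \<odot>\<^bsub>E\<^esub> x j)) = norm a * snd (X E) (fin_seq E k x)"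
proof -
  interpret normed_space E
    using E by (rule normed_spaceI)
  have "fin_seq E k (\<lambda>j. a \<odot>\<^bsub>E\<^esub> x j) = (\<lambda>j. a \<odot>\<^bsub>E\<^esub> fin_seq E k x j)"
    by (auto simp: fin_seq_def)
  then show ?thesis
    using seq_norm_smult[OF E fin_seq_closed[OF assms]] by simp
qed

lemma fin_seq_singleton:
  assumes "banach_space E" "x 0 \<in> carrier E"
  shows "snd (X E) (fin_seq E 1 x) = vnorm E (x 0)"
proof -
  have "fin_seq E 1 x = single_seq E 0 (x 0)"
    by (auto simp: fin_seq_def single_seq_def)
  then show ?thesis
    using single_seq[OF assms] by simp
qed

lemma fin_seq_linear_image:
  "\<lbrakk>banach_space E; banach_space F; u \<in> cpoly 1 E F; x \<in> {..<k} \<rightarrow> carrier E\<rbrakk> \<Longrightarrow>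
    snd (X F) (fin_seq F k (\<lambda>j. u (x j))) \<le> poly_norm E F u * snd (X E) (fin_seq E k x)"
  using seq_fun by (simp add: seq_functor_def)

end

text \<open>Replaces an infimum over constants, and a division by a norm that may vanish, by a constant
  with some slack.\<close>

lemma le_mult_if_le_mult_add:
  fixes a r w :: real
  assumes le: "\<And>e. 0 < e \<Longrightarrow> a \<le> (r + e) * w" and w: "0 \<le> w"
  shows "a \<le> r * w"
proof (rule field_le_epsilon)
  fix e :: real
  assume e: "0 < e"
  then have "a \<le> (r + e / (w + 1)) * w"
    using w by (intro le) simp
  also have "\<dots> = r * w + e * (w / (w + 1))"
    by (simp add: algebra_simps)
  also have "\<dots> \<le> r * w + e * 1"
    using e w by (intro add_left_mono mult_left_mono) auto
  finally show "a \<le> r * w + e"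
    by simp
qed

lemma powr_le_powrD:
  fixes a b p :: real
  assumes "a powr p \<le> b powr p" "0 < p" "0 \<le> a" "0 \<le> b"
  shows "a \<le> b"
  using assms powr_less_mono2[of p b a] by (meson leD leI)

context sequence_functor
begin

text \<open>On sequences of a fixed finite length the norm of \<open>X F\<close> is controlled by the norms of the
  coordinates, so coordinatewise convergence is convergence in \<open>X F\<close> and bounds on the norm
  survive it.\<close>

lemma fin_seq_norm_limit:
  assumes F: "banach_space F"
    and lim: "\<And>l. l < k \<Longrightarrow> normed_space.tends_to F (\<lambda>j. y j l) (z l)"
    and le: "\<And>j. j \<ge> M \<Longrightarrow> snd (X F) (fin_seq F k (y j)) \<le> B"
  shows "snd (X F) (fin_seq F k z) \<le> B"
proof -
  interpret normed_space F
    using F by (rule normed_spaceI)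
  have y: "y j l \<in> carrier F" and z: "z l \<in> carrier F" if "l < k" for j l
    using lim[OF that] by (simp_all add: tends_to_def)
  have yP: "y j \<in> {..<k} \<rightarrow> carrier F" and zP: "z \<in> {..<k} \<rightarrow> carrier F" for j
    using y z by auto
  have B: "0 \<le> B"
    using le[of M] fin_seq_nonneg[OF F yP, of M] by linarith
  have step: "snd (X F) (fin_seq F k z) powr p \<le> B powr p + (\<Sum>l<k. vnorm F (y j l \<ominus>\<^bsub>F\<^esub> z l) powr p)"
    if j: "j \<ge> M" for j
  proof -
    let ?d = "\<lambda>l. z l \<ominus>\<^bsub>F\<^esub> y j l"
    have dP: "?d \<in> {..<k} \<rightarrow> carrier F"
      using y z by auto
    have "fin_seq F k z = fin_seq F k (\<lambda>l. ?d l \<oplus>\<^bsub>F\<^esub> y j l)"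
    proof
      fix l
      show "fin_seq F k z l = fin_seq F k (\<lambda>l. ?d l \<oplus>\<^bsub>F\<^esub> y j l) l"
        using diff_add_diff[of "z l" "y j l" "\<zero>\<^bsub>F\<^esub>"] y z by (simp add: fin_seq_def)
    qed
    then have "snd (X F) (fin_seq F k z) powr p \<le>
        snd (X F) (fin_seq F k ?d) powr p + snd (X F) (fin_seq F k (y j)) powr p"
      using fin_seq_add[OF F dP yP] by simp
    moreover have "snd (X F) (fin_seq F k (y j)) powr p \<le> B powr p"
      using le[OF j] fin_seq_nonneg[OF F yP] p_pos by (intro powr_mono2) auto
    moreover have "snd (X F) (fin_seq F k ?d) powr p \<le> (\<Sum>l<k. vnorm F (?d l) powr p)"
      using fin_seq_norm[OF F dP] by simp
    moreover have "(\<Sum>l<k. vnorm F (?d l) powr p) = (\<Sum>l<k. vnorm F (y j l \<ominus>\<^bsub>F\<^esub> z l) powr p)"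
      by (intro sum.cong refl) (simp add: norm_diff_commute y z)
    ultimately show ?thesis
      by linarith
  qed
  have "(\<lambda>j. vnorm F (y j l \<ominus>\<^bsub>F\<^esub> z l) powr p) \<longlonglongrightarrow> 0" if "l < k" for l
    using lim[OF that] p_pos
    by (intro tendsto_zero_powrI[where b = p]) (simp_all add: tends_to_def)
  then have "(\<lambda>j. B powr p + (\<Sum>l<k. vnorm F (y j l \<ominus>\<^bsub>F\<^esub> z l) powr p)) \<longlonglongrightarrow> B powr p + (\<Sum>l<k. 0)"
    by (intro tendsto_add tendsto_const tendsto_sum) simp
  then have "snd (X F) (fin_seq F k z) powr p \<le> B powr p + (\<Sum>l<k. 0)"
    by (rule LIMSEQ_le_const) (use step in blast)
  then have "snd (X F) (fin_seq F k z) powr p \<le> B powr p"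
    by simp
  then show ?thesis
    by (rule powr_le_powrD[OF _ p_pos fin_seq_nonneg[OF F zP] B])
qed


section \<open>Weak norms of finite sequences\<close>

abbreviation K :: "('k, 'k + 'u) nspace" where
  "K \<equiv> scalar_space"

lemma normed_pair_scalar: "banach_space E \<Longrightarrow> normed_pair E K"
  by (intro normed_pair.intro normed_spaceI banach_space_scalar_space)

text \<open>The bound is \<open>|R(x\<^sub>j)| \<le> \<parallel>x\<^sub>j\<parallel>\<^sup>n\<close>, summed over the coordinates.\<close>

lemma weak_norm_bdd_above:
  assumes E: "banach_space E" and n: "1 \<le> n" and x: "x \<in> {..<k} \<rightarrow> carrier E"
  shows "bdd_above ((\<lambda>R. snd (X K) (fin_seq K k (\<lambda>j. R (x j)))) `
    {R \<in> cpoly n E K. poly_norm E K R \<le> 1})"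
proof -
  interpret normed_pair E K
    using E by (rule normed_pair_scalar)
  have "snd (X K) (fin_seq K k (\<lambda>j. R (x j))) \<le> (\<Sum>j<k. (vnorm E (x j) ^ n) powr p) powr (1 / p)"
    if R: "R \<in> cpoly n E K" "poly_norm E K R \<le> 1" for R
  proof -
    have Rx: "(\<lambda>j. R (x j)) \<in> {..<k} \<rightarrow> carrier K"
      using cpoly_closed[OF R(1)] x by blast
    have "vnorm K (R (x j)) \<le> vnorm E (x j) ^ n" if "j < k" for j
    proof -
      have xj: "x j \<in> carrier E"
        using x that by auto
      have "vnorm K (R (x j)) \<le> poly_norm E K R * vnorm E (x j) ^ n"
        by (rule cpoly_norm_le[OF R(1) n xj])
      also have "\<dots> \<le> 1 * vnorm E (x j) ^ n"
        using R(2) xj by (intro mult_right_mono) simp_all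
      finally show ?thesis
        by simp
    qed
    then have "(\<Sum>j<k. vnorm K (R (x j)) powr p) \<le> (\<Sum>j<k. (vnorm E (x j) ^ n) powr p)"
      using p_pos Rx by (intro sum_mono powr_mono2) auto
    then have "snd (X K) (fin_seq K k (\<lambda>j. R (x j))) powr p \<le> (\<Sum>j<k. (vnorm E (x j) ^ n) powr p)"
      using fin_seq_norm[OF banach_space_scalar_space Rx] by linarith
    then have "(snd (X K) (fin_seq K k (\<lambda>j. R (x j))) powr p) powr (1 / p) \<le>
        (\<Sum>j<k. (vnorm E (x j) ^ n) powr p) powr (1 / p)"
      using p_pos by (intro powr_mono2) auto
    then show ?thesis
      using p_pos fin_seq_nonneg[OF banach_space_scalar_space Rx] by (simp add: powr_powr)
  qed
  then show ?thesis
    by (intro bdd_aboveI2) auto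
qed

lemma weak_norm_upper:
  assumes "banach_space E" "1 \<le> n" "x \<in> {..<k} \<rightarrow> carrier E"
    and "R \<in> cpoly n E K" "poly_norm E K R \<le> 1"
  shows "snd (X K) (fin_seq K k (\<lambda>j. R (x j))) \<le> weak_poly_norm X n E k x"
  unfolding weak_poly_norm_def
  by (rule cSUP_upper[OF _ weak_norm_bdd_above[OF assms(1-3)]]) (use assms(4,5) in simp)

lemma zero_in_poly_ball:
  assumes "banach_space E"
  shows "(\<lambda>x\<in>carrier E. \<zero>\<^bsub>K\<^esub>) \<in> cpoly n E K" "poly_norm E K (\<lambda>x\<in>carrier E. \<zero>\<^bsub>K\<^esub>) \<le> 1"
proof -
  interpret normed_pair E K
    using assms by (rule normed_pair_scalar)
  show "(\<lambda>x\<in>carrier E. \<zero>\<^bsub>K\<^esub>) \<in> cpoly n E K"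
    by (rule cpoly_zero)
  show "poly_norm E K (\<lambda>x\<in>carrier E. \<zero>\<^bsub>K\<^esub>) \<le> 1"
    by (rule poly_norm_le[where n = 1]) auto
qed

lemma weak_norm_nonneg:
  assumes E: "banach_space E" "1 \<le> n" and x: "x \<in> {..<k} \<rightarrow> carrier E"
  shows "0 \<le> weak_poly_norm X n E k x"
proof -
  let ?R = "\<lambda>x\<in>carrier E. \<zero>\<^bsub>K\<^esub>"
  have "0 \<le> snd (X K) (fin_seq K k (\<lambda>j. ?R (x j)))"
    using x by (intro fin_seq_nonneg banach_space_scalar_space) (auto simp: Pi_iff)
  also have "\<dots> \<le> weak_poly_norm X n E k x"
    by (rule weak_norm_upper[OF E x zero_in_poly_ball[OF E(1)]])
  finally show ?thesis .
qed

text \<open>Dividing \<open>R\<close> by anything larger than its norm puts it into the unit ball over which the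
  supremum is taken.\<close>

lemma weak_norm_scalar_poly:
  assumes E: "banach_space E" and n: "1 \<le> n" and x: "x \<in> {..<k} \<rightarrow> carrier E" and R: "R \<in> cpoly n E K"
  shows "snd (X K) (fin_seq K k (\<lambda>j. R (x j))) \<le> poly_norm E K R * weak_poly_norm X n E k x"
proof (rule le_mult_if_le_mult_add[OF _ weak_norm_nonneg[OF E n x]])
  interpret normed_pair E K
    using E by (rule normed_pair_scalar)
  fix e :: real
  assume e: "0 < e"
  define c where "c = poly_norm E K R + e"
  have c: "0 < c"
    using poly_norm_nonneg[OF R n] e by (simp add: c_def)
  let ?S = "\<lambda>x\<in>carrier E. of_real (1 / c) \<odot>\<^bsub>K\<^esub> R x"
  have "poly_norm E K ?S \<le> 1"
  proof (rule poly_norm_le[where n = n])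
    fix x
    assume x: "x \<in> carrier E"
    have "vnorm K (?S x) = vnorm K (R x) / c"
      using x c cpoly_closed[OF R x] F.norm_smult[of "R x" "of_real (1 / c)"] by (simp add: norm_mult norm_divide)
    also have "\<dots> \<le> poly_norm E K R * vnorm E x ^ n / c"
      using c by (intro divide_right_mono cpoly_norm_le[OF R n x]) simp
    also have "\<dots> \<le> c * vnorm E x ^ n / c"
      using c e x by (intro divide_right_mono mult_right_mono) (simp_all add: c_def)
    finally show "vnorm K (?S x) \<le> 1 * vnorm E x ^ n"
      using c by simp
  qed simp
  then have "snd (X K) (fin_seq K k (\<lambda>j. ?S (x j))) \<le> weak_poly_norm X n E k x"
    by (rule weak_norm_upper[OF E n x cpoly_smult[OF R]])
  moreover have "fin_seq K k (\<lambda>j. ?S (x j)) = fin_seq K k (\<lambda>j. of_real (1 / c) \<odot>\<^bsub>K\<^esub> R (x j))"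
    using x by (auto simp: fin_seq_def fun_eq_iff)
  moreover have "snd (X K) (fin_seq K k (\<lambda>j. of_real (1 / c) \<odot>\<^bsub>K\<^esub> R (x j))) =
      norm (of_real (1 / c) :: 'k) * snd (X K) (fin_seq K k (\<lambda>j. R (x j)))"
    by (rule fin_seq_smult[OF banach_space_scalar_space]) (use x cpoly_closed[OF R] in blast)
  moreover have "norm (of_real (1 / c) :: 'k) = 1 / c"
    using c by (simp only: norm_of_real) simp
  ultimately have "snd (X K) (fin_seq K k (\<lambda>j. R (x j))) / c \<le> weak_poly_norm X n E k x"
    by simp
  then show "snd (X K) (fin_seq K k (\<lambda>j. R (x j))) \<le> (poly_norm E K R + e) * weak_poly_norm X n E k x"
    unfolding c_def[symmetric] using c by (simp add: field_simps)
qed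

lemma weak_norm_singleton:
  assumes E: "banach_space E" and n: "1 \<le> n" and x: "x 0 \<in> carrier E"
  shows "weak_poly_norm X n E 1 x \<le> vnorm E (x 0) ^ n"
  unfolding weak_poly_norm_def
proof (rule cSUP_least)
  interpret normed_pair E K
    using E by (rule normed_pair_scalar)
  show "{R \<in> cpoly n E K. poly_norm E K R \<le> 1} \<noteq> {}"
    using zero_in_poly_ball[OF E] by blast
  fix R
  assume "R \<in> {R \<in> cpoly n E K. poly_norm E K R \<le> 1}"
  then have R: "R \<in> cpoly n E K" "poly_norm E K R \<le> 1"
    by auto
  have "snd (X K) (fin_seq K 1 (\<lambda>j. R (x j))) = vnorm K (R (x 0))"
    using cpoly_closed[OF R(1) x] by (rule fin_seq_singleton[OF banach_space_scalar_space])
  also have "\<dots> \<le> poly_norm E K R * vnorm E (x 0) ^ n"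
    by (rule cpoly_norm_le[OF R(1) n x])
  also have "\<dots> \<le> 1 * vnorm E (x 0) ^ n"
    using R(2) x by (intro mult_right_mono) simp_all
  finally show "snd (X K) (fin_seq K 1 (\<lambda>j. R (x j))) \<le> vnorm E (x 0) ^ n"
    by simp
qed

text \<open>For \<open>S\<close> in the unit ball, \<open>S \<circ> R\<close> is a polynomial of degree \<open>m n\<close> and norm at most
  \<open>\<parallel>R\<parallel>\<^sup>n\<close>. This is where the supremum over polynomials, rather than over functionals, makes
  the composition property work.\<close>

lemma weak_norm_compose:
  assumes E: "banach_space E" and G: "banach_space G" and n: "1 \<le> n" and m: "1 \<le> m"
    and R: "R \<in> cpoly m G E" and x: "x \<in> {..<k} \<rightarrow> carrier G"
  shows "weak_poly_norm X n E k (\<lambda>j. R (x j)) \<le> poly_norm G E R ^ n * weak_poly_norm X (m * n) G k x"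
  unfolding weak_poly_norm_def[of X n E]
proof (rule cSUP_least)
  have mn: "1 \<le> m * n"
    using m n by simp
  interpret GE: normed_pair G E
    using G E by (intro normed_pair.intro normed_spaceI)
  show "{R \<in> cpoly n E K. poly_norm E K R \<le> 1} \<noteq> {}"
    using zero_in_poly_ball[OF E] by blast
  fix S
  assume "S \<in> {R \<in> cpoly n E K. poly_norm E K R \<le> 1}"
  then have S: "S \<in> cpoly n E K" "poly_norm E K S \<le> 1"
    by auto
  let ?SR = "\<lambda>x\<in>carrier G. S (R x)"
  have "fin_seq K k (\<lambda>j. S (R (x j))) = fin_seq K k (\<lambda>j. ?SR (x j))"
    using x by (auto simp: fin_seq_def fun_eq_iff)
  then have "snd (X K) (fin_seq K k (\<lambda>j. S (R (x j)))) \<le> poly_norm G K ?SR * weak_poly_norm X (m * n) G k x"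
    using weak_norm_scalar_poly[OF G mn x cpoly_compose[OF S(1) R]] by simp
  also have "\<dots> \<le> (poly_norm E K S * poly_norm G E R ^ n) * weak_poly_norm X (m * n) G k x"
    by (intro mult_right_mono weak_norm_nonneg[OF G mn x]
        poly_norm_compose_le[OF E banach_space_scalar_space G S(1) n R m])
  also have "\<dots> \<le> (1 * poly_norm G E R ^ n) * weak_poly_norm X (m * n) G k x"
    using S(2) GE.poly_norm_nonneg[OF R m]
    by (intro mult_right_mono weak_norm_nonneg[OF G mn x]) auto
  finally show "snd (X K) (fin_seq K k (\<lambda>j. S (R (x j)))) \<le>
      poly_norm G E R ^ n * weak_poly_norm X (m * n) G k x"
    by simp
qed

end


section \<open>Summing polynomials\<close>

locale functor_pair = X?: sequence_functor X p + Y?: sequence_functor Y q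
  for X :: "('k::{real_normed_field, banach}, 'u) seq_corr" and Y :: "('k, 'u) seq_corr" and p q :: real
begin

text \<open>The inequality that defines summing polynomials, for constants that may be \<open>0\<close>: in this
  form the infimum of the admissible constants is itself admissible.\<close>

definition summing_bound ::
  "nat \<Rightarrow> ('k, 'k + 'u) nspace \<Rightarrow> ('k, 'k + 'u) nspace \<Rightarrow> ('k + 'u \<Rightarrow> 'k + 'u) \<Rightarrow> real \<Rightarrow> bool" where
  "summing_bound n E F P B \<longleftrightarrow> (\<forall>k. \<forall>x \<in> {..<k} \<rightarrow> carrier E.
     snd (Y F) (fin_seq F k (\<lambda>j. P (x j))) \<le> B * weak_poly_norm X n E k x)"

abbreviation summing :: "nat \<Rightarrow> ('k, 'k + 'u) nspace \<Rightarrow> ('k, 'k + 'u) nspace \<Rightarrow> ('k + 'u \<Rightarrow> 'k + 'u) set" where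
  "summing n E F \<equiv> fst (summing_polys X Y n E F)"

abbreviation summing_norm :: "nat \<Rightarrow> ('k, 'k + 'u) nspace \<Rightarrow> ('k, 'k + 'u) nspace \<Rightarrow> ('k + 'u \<Rightarrow> 'k + 'u) \<Rightarrow> real" where
  "summing_norm n E F \<equiv> snd (summing_polys X Y n E F)"

lemma summing_boundD:
  "summing_bound n E F P B \<Longrightarrow> x \<in> {..<k} \<rightarrow> carrier E \<Longrightarrow>
    snd (Y F) (fin_seq F k (\<lambda>j. P (x j))) \<le> B * weak_poly_norm X n E k x"
  by (simp add: summing_bound_def)

lemma summing_const_iff: "summing_const X Y n E F P C \<longleftrightarrow> 0 < C \<and> summing_bound n E F P C"
  by (simp add: summing_const_def summing_bound_def)

lemma summing_cpoly: "P \<in> summing n E F \<Longrightarrow> P \<in> cpoly n E F"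
  by (simp add: summing_polys_def)

lemma summing_bound_mono:
  assumes "banach_space E" "1 \<le> n" "summing_bound n E F P B" "B \<le> C"
  shows "summing_bound n E F P C"
  unfolding summing_bound_def
proof (intro allI ballI)
  fix k x
  assume x: "x \<in> {..<k::nat} \<rightarrow> carrier E"
  have "B * weak_poly_norm X n E k x \<le> C * weak_poly_norm X n E k x"
    using assms(4) by (intro mult_right_mono X.weak_norm_nonneg[OF assms(1,2) x])
  then show "snd (Y F) (fin_seq F k (\<lambda>j. P (x j))) \<le> C * weak_poly_norm X n E k x"
    using summing_boundD[OF assms(3) x] by linarith
qed

lemma summingI:
  assumes "banach_space E" "1 \<le> n" "P \<in> cpoly n E F" "summing_bound n E F P B" "0 \<le> B"
  shows "P \<in> summing n E F" "summing_norm n E F P \<le> B"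
proof -
  have const: "summing_const X Y n E F P (B + e)" if "0 < e" for e
    unfolding summing_const_iff using that assms summing_bound_mono by auto
  then show "P \<in> summing n E F"
    using assms(3) const[OF zero_less_one] unfolding summing_polys_def by fastforce
  have "bdd_below {C. summing_const X Y n E F P C}"
    by (intro bdd_belowI[of _ 0]) (simp add: summing_const_iff)
  then have "summing_norm n E F P \<le> B + e" if "0 < e" for e
    unfolding summing_polys_def using const[OF that] by (auto intro: cInf_lower)
  then show "summing_norm n E F P \<le> B"
    by (rule field_le_epsilon)
qed

lemma summing_norm_nonneg: "P \<in> summing n E F \<Longrightarrow> 0 \<le> summing_norm n E F P"
  unfolding summing_polys_def
  by (auto intro!: cInf_greatest simp: summing_const_iff)

lemma summing_bound_norm:
  assumes "banach_space E" "1 \<le> n" "P \<in> summing n E F"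
  shows "summing_bound n E F P (summing_norm n E F P)"
  unfolding summing_bound_def
proof (intro allI ballI)
  fix k x
  assume x: "x \<in> {..<k::nat} \<rightarrow> carrier E"
  let ?C = "{C. summing_const X Y n E F P C}"
  show "snd (Y F) (fin_seq F k (\<lambda>j. P (x j))) \<le> summing_norm n E F P * weak_poly_norm X n E k x"
  proof (rule le_mult_if_le_mult_add[OF _ X.weak_norm_nonneg[OF assms(1,2) x]])
    fix e :: real
    assume "0 < e"
    moreover have "?C \<noteq> {}"
      using assms(3) by (auto simp: summing_polys_def)
    ultimately obtain C where C: "C \<in> ?C" "C < Inf ?C + e"
      by (meson cInf_lessD less_add_same_cancel1)
    then have "summing_bound n E F P C" "C \<le> summing_norm n E F P + e"
      by (simp_all add: summing_const_iff summing_polys_def)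
    then have "summing_bound n E F P (summing_norm n E F P + e)"
      by (rule summing_bound_mono[OF assms(1,2)])
    then show "snd (Y F) (fin_seq F k (\<lambda>j. P (x j))) \<le> (summing_norm n E F P + e) * weak_poly_norm X n E k x"
      using x by (rule summing_boundD)
  qed
qed

text \<open>Sequences of length one: the summing norm dominates the sup norm.\<close>

lemma summing_bound_pointwise:
  assumes E: "banach_space E" and F: "banach_space F" and n: "1 \<le> n" and B: "summing_bound n E F P B" "0 \<le> B"
    and x: "x \<in> carrier E" "P x \<in> carrier F"
  shows "vnorm F (P x) \<le> B * vnorm E x ^ n"
proof -
  have "vnorm F (P x) = snd (Y F) (fin_seq F 1 (\<lambda>j. P x))"
    using Y.fin_seq_singleton[OF F, of "\<lambda>j. P x"] x by simp
  also have "\<dots> \<le> B * weak_poly_norm X n E 1 (\<lambda>j. x)"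
    using summing_boundD[OF B(1), of "\<lambda>j. x" 1] x by simp
  also have "\<dots> \<le> B * vnorm E x ^ n"
    using B(2) X.weak_norm_singleton[OF E n, of "\<lambda>j. x"] x by (intro mult_left_mono) auto
  finally show ?thesis .
qed

lemma cpoly_image: "P \<in> cpoly n E F \<Longrightarrow> x \<in> {..<k} \<rightarrow> carrier E \<Longrightarrow> (\<lambda>j. P (x j)) \<in> {..<k} \<rightarrow> carrier F"
  by (intro funcsetI) (auto intro!: cpoly_closed[of P n E F])

lemma fin_seq_cong: "(\<And>j. j < k \<Longrightarrow> x j = y j) \<Longrightarrow> fin_seq E k x = fin_seq E k y"
  by (auto simp: fin_seq_def)

end

section \<open>The \<open>q\<close>-Banach space of summing polynomials\<close>

locale summing_component = functor_pair X Y p q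
  for X :: "('k::{real_normed_field, banach}, 'u) seq_corr" and Y :: "('k, 'u) seq_corr" and p q :: real +
  fixes n :: nat and E F :: "('k, 'k + 'u) nspace"
  assumes n: "1 \<le> n" and bE: "banach_space E" and bF: "banach_space F"
begin

sublocale normed_pair E F
  using bE bF by (intro normed_pair.intro normed_spaceI)

lemma summing_zero:
  shows "(\<lambda>x\<in>carrier E. \<zero>\<^bsub>F\<^esub>) \<in> summing n E F" "summing_norm n E F (\<lambda>x\<in>carrier E. \<zero>\<^bsub>F\<^esub>) = 0"
proof -
  have "summing_bound n E F (\<lambda>x\<in>carrier E. \<zero>\<^bsub>F\<^esub>) 0"
    unfolding summing_bound_def
  proof (intro allI ballI)
    fix k x
    assume x: "x \<in> {..<k::nat} \<rightarrow> carrier E"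
    have "fin_seq F k (\<lambda>j. (\<lambda>x\<in>carrier E. \<zero>\<^bsub>F\<^esub>) (x j)) = (\<lambda>j. \<zero>\<^bsub>F\<^esub>)"
      using x by (auto simp: fin_seq_def fun_eq_iff)
    then show "snd (Y F) (fin_seq F k (\<lambda>j. (\<lambda>x\<in>carrier E. \<zero>\<^bsub>F\<^esub>) (x j))) \<le> 0 * weak_poly_norm X n E k x"
      using Y.seq_norm_zero[OF bF] by simp
  qed
  note * = summingI[OF bE n cpoly_zero this order_refl]
  show "(\<lambda>x\<in>carrier E. \<zero>\<^bsub>F\<^esub>) \<in> summing n E F"
    by (rule *(1))
  show "summing_norm n E F (\<lambda>x\<in>carrier E. \<zero>\<^bsub>F\<^esub>) = 0"
    using *(2) summing_norm_nonneg[OF *(1)] by (rule order_antisym)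
qed

lemma summing_add:
  assumes P: "P \<in> summing n E F" and Q: "Q \<in> summing n E F"
  shows "(\<lambda>x\<in>carrier E. P x \<oplus>\<^bsub>F\<^esub> Q x) \<in> summing n E F"
    and "summing_norm n E F (\<lambda>x\<in>carrier E. P x \<oplus>\<^bsub>F\<^esub> Q x) powr q
      \<le> summing_norm n E F P powr q + summing_norm n E F Q powr q"
proof -
  let ?PQ = "\<lambda>x\<in>carrier E. P x \<oplus>\<^bsub>F\<^esub> Q x"
  define a where "a = summing_norm n E F P"
  define b where "b = summing_norm n E F Q"
  \<comment> \<open>The constant for which the \<open>q\<close>-triangle inequality in \<open>Y F\<close> gives back the one for the norm.\<close>
  define c where "c = (a powr q + b powr q) powr (1 / q)"
  have nonneg: "0 \<le> a" "0 \<le> b" "0 \<le> c"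
    using summing_norm_nonneg[OF P] summing_norm_nonneg[OF Q] by (simp_all add: a_def b_def c_def)
  have cq: "c powr q = a powr q + b powr q"
    using Y.p_pos by (simp add: c_def powr_powr)
  have "summing_bound n E F ?PQ c"
    unfolding summing_bound_def
  proof (intro allI ballI)
    fix k x
    assume x: "x \<in> {..<k::nat} \<rightarrow> carrier E"
    let ?w = "weak_poly_norm X n E k x"
    let ?N = "\<lambda>P. snd (Y F) (fin_seq F k (\<lambda>j. P (x j)))"
    have w: "0 \<le> ?w"
      by (rule X.weak_norm_nonneg[OF bE n x])
    note Px = cpoly_image[OF summing_cpoly[OF P] x]
    note Qx = cpoly_image[OF summing_cpoly[OF Q] x]
    have PQ: "fin_seq F k (\<lambda>j. ?PQ (x j)) = fin_seq F k (\<lambda>j. P (x j) \<oplus>\<^bsub>F\<^esub> Q (x j))"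
      using x by (intro fin_seq_cong) auto
    have "?N ?PQ powr q \<le> ?N P powr q + ?N Q powr q"
      unfolding PQ by (rule Y.fin_seq_add[OF bF Px Qx])
    also have "\<dots> \<le> (a * ?w) powr q + (b * ?w) powr q"
      using summing_boundD[OF summing_bound_norm[OF bE n P] x] summing_boundD[OF summing_bound_norm[OF bE n Q] x]
        Y.fin_seq_nonneg[OF bF Px] Y.fin_seq_nonneg[OF bF Qx] Y.p_pos
      by (intro add_mono powr_mono2) (auto simp: a_def b_def)
    also have "\<dots> = (c * ?w) powr q"
      using nonneg w by (simp add: powr_mult cq ring_distribs)
    finally have "?N ?PQ powr q \<le> (c * ?w) powr q" .
    moreover have "0 \<le> ?N ?PQ"
      by (rule Y.fin_seq_nonneg[OF bF cpoly_image[OF cpoly_add[OF summing_cpoly[OF P] summing_cpoly[OF Q]] x]])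
    moreover have "0 \<le> c * ?w"
      using nonneg w by simp
    ultimately show "?N ?PQ \<le> c * ?w"
      by (rule powr_le_powrD[OF _ Y.p_pos])
  qed
  note * = summingI[OF bE n cpoly_add[OF summing_cpoly[OF P] summing_cpoly[OF Q]] this nonneg(3)]
  show "?PQ \<in> summing n E F"
    by (rule *(1))
  have "summing_norm n E F ?PQ powr q \<le> c powr q"
    using * summing_norm_nonneg Y.p_pos by (intro powr_mono2) auto
  then show "summing_norm n E F ?PQ powr q \<le> summing_norm n E F P powr q + summing_norm n E F Q powr q"
    unfolding cq a_def b_def .
qed

lemma summing_smult_le:
  assumes P: "P \<in> summing n E F"
  shows "(\<lambda>x\<in>carrier E. a \<odot>\<^bsub>F\<^esub> P x) \<in> summing n E F"
    and "summing_norm n E F (\<lambda>x\<in>carrier E. a \<odot>\<^bsub>F\<^esub> P x) \<le> norm a * summing_norm n E F P"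
proof -
  let ?aP = "\<lambda>x\<in>carrier E. a \<odot>\<^bsub>F\<^esub> P x"
  have "summing_bound n E F ?aP (norm a * summing_norm n E F P)"
    unfolding summing_bound_def
  proof (intro allI ballI)
    fix k x
    assume x: "x \<in> {..<k::nat} \<rightarrow> carrier E"
    have "fin_seq F k (\<lambda>j. ?aP (x j)) = fin_seq F k (\<lambda>j. a \<odot>\<^bsub>F\<^esub> P (x j))"
      using x by (intro fin_seq_cong) auto
    then have "snd (Y F) (fin_seq F k (\<lambda>j. ?aP (x j))) = norm a * snd (Y F) (fin_seq F k (\<lambda>j. P (x j)))"
      using Y.fin_seq_smult[OF bF cpoly_image[OF summing_cpoly[OF P] x]] by simp
    also have "\<dots> \<le> norm a * (summing_norm n E F P * weak_poly_norm X n E k x)"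
      by (intro mult_left_mono summing_boundD[OF summing_bound_norm[OF bE n P] x]) simp
    finally show "snd (Y F) (fin_seq F k (\<lambda>j. ?aP (x j))) \<le>
        norm a * summing_norm n E F P * weak_poly_norm X n E k x"
      by (simp add: mult.assoc)
  qed
  note * = summingI[OF bE n cpoly_smult[OF summing_cpoly[OF P]] this]
  show "?aP \<in> summing n E F" "summing_norm n E F ?aP \<le> norm a * summing_norm n E F P"
    using * summing_norm_nonneg[OF P] by simp_all
qed

text \<open>The lower estimate is \<open>summing_smult_le\<close> for the scalar \<open>inverse a\<close> and the polynomial \<open>a P\<close>.\<close>

lemma summing_norm_smult:
  assumes P: "P \<in> summing n E F"
  shows "summing_norm n E F (\<lambda>x\<in>carrier E. a \<odot>\<^bsub>F\<^esub> P x) = norm a * summing_norm n E F P"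
proof (cases "a = 0")
  case True
  have "(\<lambda>x\<in>carrier E. a \<odot>\<^bsub>F\<^esub> P x) = (\<lambda>x\<in>carrier E. \<zero>\<^bsub>F\<^esub>)"
    using summing_cpoly[OF P] by (intro restrict_ext) (simp add: True cpoly_closed)
  then show ?thesis
    using summing_zero(2) True by simp
next
  case False
  let ?aP = "\<lambda>x\<in>carrier E. a \<odot>\<^bsub>F\<^esub> P x"
  have "(\<lambda>x\<in>carrier E. inverse a \<odot>\<^bsub>F\<^esub> ?aP x) = P"
  proof (rule extensionalityI[OF _ cpoly_extensional[OF summing_cpoly[OF P]]])
    fix x
    assume "x \<in> carrier E"
    then show "(\<lambda>x\<in>carrier E. inverse a \<odot>\<^bsub>F\<^esub> ?aP x) x = P x"
      using cpoly_closed[OF summing_cpoly[OF P]] False by (simp add: F.smult_assoc)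
  qed simp
  then have "summing_norm n E F P \<le> norm (inverse a) * summing_norm n E F ?aP"
    using summing_smult_le(2)[OF summing_smult_le(1)[OF P, of a], of "inverse a"] by simp
  then have "norm a * summing_norm n E F P \<le> norm a * (norm (inverse a) * summing_norm n E F ?aP)"
    by (intro mult_left_mono) simp_all
  also have "\<dots> = summing_norm n E F ?aP"
    using False by (simp add: norm_inverse)
  finally have "norm a * summing_norm n E F P \<le> summing_norm n E F ?aP" .
  then show ?thesis
    using summing_smult_le(2)[OF P, of a] by linarith
qed

lemma summing_norm_eq_zero:
  assumes P: "P \<in> summing n E F" and "summing_norm n E F P = 0"
  shows "P = (\<lambda>x\<in>carrier E. \<zero>\<^bsub>F\<^esub>)"
proof (rule cpoly_ext[OF summing_cpoly[OF P] cpoly_zero])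
  fix x
  assume x: "x \<in> carrier E"
  note Px = cpoly_closed[OF summing_cpoly[OF P] x]
  have "vnorm F (P x) \<le> 0 * vnorm E x ^ n"
    using summing_bound_pointwise[OF bE bF n summing_bound_norm[OF bE n P] _ x Px] assms(2) by simp
  then have "vnorm F (P x) = 0"
    using F.norm_nonneg[OF Px] by simp
  then show "P x = (\<lambda>x\<in>carrier E. \<zero>\<^bsub>F\<^esub>) x"
    using x Px by simp
qed

lemma submodule_summing: "submodule (summing n E F) scalar_ring (cpoly_module n E F)"
proof (rule module.submoduleI[OF linear_space.module_V[OF linear_space_cpoly_module]])
  interpret M: linear_space "cpoly_module n E F"
    by (rule linear_space_cpoly_module)
  show sub: "summing n E F \<subseteq> carrier (cpoly_module n E F)"
    by (auto simp: cpoly_module_def summing_cpoly)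
  show "\<zero>\<^bsub>cpoly_module n E F\<^esub> \<in> summing n E F"
    using summing_zero(1) by (simp add: cpoly_module_def)
  show "P \<oplus>\<^bsub>cpoly_module n E F\<^esub> Q \<in> summing n E F" if "P \<in> summing n E F" "Q \<in> summing n E F" for P Q
    using summing_add(1)[OF that] by (simp add: cpoly_module_def)
  show smult: "a \<odot>\<^bsub>cpoly_module n E F\<^esub> P \<in> summing n E F" if "P \<in> summing n E F" for a P
    using summing_smult_le(1)[OF that] by (simp add: cpoly_module_def)
  show "\<ominus>\<^bsub>cpoly_module n E F\<^esub> P \<in> summing n E F" if "P \<in> summing n E F" for P
    using smult[OF that] sub that by (simp add: M.minus_conv_smult subset_iff)
qed

abbreviation summing_module :: "('k, 'k + 'u \<Rightarrow> 'k + 'u) module" where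
  "summing_module \<equiv> (cpoly_module n E F)\<lparr>carrier := summing n E F\<rparr>"

lemma linear_space_summing: "linear_space summing_module"
  using submodule.submodule_is_module[OF submodule_summing linear_space.module_V[OF linear_space_cpoly_module]]
  by (rule linear_space.intro)

lemma summing_diff:
  assumes P: "P \<in> summing n E F" and Q: "Q \<in> summing n E F"
  shows "P \<ominus>\<^bsub>summing_module\<^esub> Q = (\<lambda>x\<in>carrier E. P x \<ominus>\<^bsub>F\<^esub> Q x)"
proof -
  have "P \<ominus>\<^bsub>summing_module\<^esub> Q = P \<oplus>\<^bsub>summing_module\<^esub> (- 1) \<odot>\<^bsub>summing_module\<^esub> Q"
    using Q by (intro linear_space.diff_conv_smult[OF linear_space_summing]) simp
  also have "\<dots> = (\<lambda>x\<in>carrier E. P x \<ominus>\<^bsub>F\<^esub> Q x)"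
    using cpoly_closed[OF summing_cpoly[OF Q]]
    by (auto simp: cpoly_module_def F.diff_conv_smult fun_eq_iff)
  finally show ?thesis .
qed

text \<open>A Cauchy sequence converges pointwise, because the summing norm dominates the sup norm.
  Letting one index tend to infinity in the inequalities for the differences \<open>s i - s j\<close> shows
  that \<open>s i - Q\<close> satisfies them too, where \<open>Q\<close> is the pointwise limit. So the convergence is
  uniform on balls, which makes \<open>Q\<close> a polynomial, and it takes place in the summing norm.\<close>

lemma summing_complete: "complete_on summing_module (summing_norm n E F)"
  unfolding complete_on_def
proof (intro allI impI, elim conjE)
  fix s
  assume "\<forall>i::nat. s i \<in> carrier summing_module"
    and Cauchy: "\<forall>e>0. \<exists>M. \<forall>i\<ge>M. \<forall>j\<ge>M. summing_norm n E F (s i \<ominus>\<^bsub>summing_module\<^esub> s j) < e"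
  then have s: "s i \<in> summing n E F" for i
    by simp
  define D where "D i j = (\<lambda>x\<in>carrier E. s i x \<ominus>\<^bsub>F\<^esub> s j x)" for i j
  have D: "s i \<ominus>\<^bsub>summing_module\<^esub> s j = D i j" "D i j \<in> summing n E F" for i j
  proof -
    show eq: "s i \<ominus>\<^bsub>summing_module\<^esub> s j = D i j"
      unfolding D_def by (rule summing_diff[OF s s])
    have "s i \<ominus>\<^bsub>summing_module\<^esub> s j \<in> carrier summing_module"
      by (rule abelian_group.minus_closed[OF module.axioms(2)[OF linear_space.module_V[OF linear_space_summing]]])
        (use s in simp_all)
    then show "D i j \<in> summing n E F"
      using eq by simp
  qed
  have sx: "s i x \<in> carrier F" if "x \<in> carrier E" for i x
    using cpoly_closed[OF summing_cpoly[OF s] that] .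
  have D_le: "vnorm F (s i x \<ominus>\<^bsub>F\<^esub> s j x) \<le> summing_norm n E F (D i j) * vnorm E x ^ n"
    if x: "x \<in> carrier E" for i j x
    using summing_bound_pointwise[OF bE bF n summing_bound_norm[OF bE n D(2)] summing_norm_nonneg[OF D(2)] x]
      x sx by (simp add: D_def)
  have "\<exists>l. F.tends_to (\<lambda>i. s i x) l" if x: "x \<in> carrier E" for x
  proof (rule F.Cauchy_tends_to)
    fix e :: real
    assume e: "0 < e"
    have pos: "0 < vnorm E x ^ n + 1"
      using x by (simp add: add_nonneg_pos)
    then obtain M where M: "\<And>i j. i \<ge> M \<Longrightarrow> j \<ge> M \<Longrightarrow> summing_norm n E F (D i j) < e / (vnorm E x ^ n + 1)"
      using Cauchy e unfolding D(1) by (meson divide_pos_pos)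
    have "vnorm F (s i x \<ominus>\<^bsub>F\<^esub> s j x) < e" if "i \<ge> M" "j \<ge> M" for i j
    proof -
      have "vnorm F (s i x \<ominus>\<^bsub>F\<^esub> s j x) \<le> e / (vnorm E x ^ n + 1) * vnorm E x ^ n"
        using D_le[OF x, of i j] mult_right_mono[OF less_imp_le[OF M[OF that]], of "vnorm E x ^ n"] x by simp
      also have "\<dots> < e"
        using e pos by (simp add: field_simps)
      finally show ?thesis .
    qed
    then show "\<exists>M. \<forall>i\<ge>M. \<forall>j\<ge>M. vnorm F (s i x \<ominus>\<^bsub>F\<^esub> s j x) < e"
      by blast
  qed (rule sx[OF x])
  then have "\<forall>x\<in>carrier E. \<exists>l. F.tends_to (\<lambda>i. s i x) l"
    by blast
  then obtain L where L: "\<And>x. x \<in> carrier E \<Longrightarrow> F.tends_to (\<lambda>i. s i x) (L x)"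
    unfolding bchoice_iff by blast
  define Q where "Q = restrict L (carrier E)"
  have lim: "F.tends_to (\<lambda>i. s i x) (Q x)" if "x \<in> carrier E" for x
    using L[OF that] that by (simp add: Q_def)
  have Qx: "Q x \<in> carrier F" if "x \<in> carrier E" for x
    using lim[OF that] by (simp add: F.tends_to_def)
  have bound: "\<exists>M. \<forall>i\<ge>M. summing_bound n E F (\<lambda>x\<in>carrier E. s i x \<ominus>\<^bsub>F\<^esub> Q x) e" if e: "0 < e" for e
  proof -
    obtain M where M: "\<And>i j. i \<ge> M \<Longrightarrow> j \<ge> M \<Longrightarrow> summing_norm n E F (D i j) < e"
      using Cauchy e unfolding D(1) by blast
    have "summing_bound n E F (\<lambda>x\<in>carrier E. s i x \<ominus>\<^bsub>F\<^esub> Q x) e" if i: "i \<ge> M" for i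
      unfolding summing_bound_def
    proof (intro allI ballI)
      fix k x
      assume x: "x \<in> {..<k::nat} \<rightarrow> carrier E"
      have xl: "x l \<in> carrier E" if "l < k" for l
        using x that by auto
      show "snd (Y F) (fin_seq F k (\<lambda>l. (\<lambda>x\<in>carrier E. s i x \<ominus>\<^bsub>F\<^esub> Q x) (x l))) \<le> e * weak_poly_norm X n E k x"
      proof (rule Y.fin_seq_norm_limit[OF bF])
        fix l
        assume l: "l < k"
        have "F.tends_to (\<lambda>j. s i (x l)) (s i (x l))"
          using sx[OF xl[OF l]] by (simp add: F.tends_to_def)
        then have "F.tends_to (\<lambda>j. s i (x l) \<ominus>\<^bsub>F\<^esub> s j (x l)) (s i (x l) \<ominus>\<^bsub>F\<^esub> Q (x l))"
          using lim[OF xl[OF l]] by (rule F.tends_to_diff)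
        then show "F.tends_to (\<lambda>j. D i j (x l)) ((\<lambda>x\<in>carrier E. s i x \<ominus>\<^bsub>F\<^esub> Q x) (x l))"
          using xl[OF l] by (simp add: D_def)
      next
        fix j
        assume j: "j \<ge> M"
        have "summing_bound n E F (D i j) e"
          by (rule summing_bound_mono[OF bE n summing_bound_norm[OF bE n D(2)] less_imp_le[OF M[OF i j]]])
        then show "snd (Y F) (fin_seq F k (\<lambda>l. D i j (x l))) \<le> e * weak_poly_norm X n E k x"
          using x by (rule summing_boundD)
      qed
    qed
    then show ?thesis
      by blast
  qed
  have Q: "Q \<in> cpoly n E F"
  proof (rule cpoly_limit[OF summing_cpoly[OF s]])
    show "Q \<in> carrier E \<rightarrow>\<^sub>E carrier F"
      using Qx by (auto simp: Q_def)
    fix e :: real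
    assume e: "0 < e"
    obtain M where M: "\<And>i. i \<ge> M \<Longrightarrow> summing_bound n E F (\<lambda>x\<in>carrier E. s i x \<ominus>\<^bsub>F\<^esub> Q x) e"
      using bound[OF e] by blast
    have "vnorm F (s i x \<ominus>\<^bsub>F\<^esub> Q x) \<le> e * vnorm E x ^ n" if "i \<ge> M" "x \<in> carrier E" for i x
      using summing_bound_pointwise[OF bE bF n M[OF that(1)] _ that(2)] e that(2) sx Qx by simp
    then show "\<exists>M. \<forall>j\<ge>M. \<forall>x\<in>carrier E. vnorm F (s j x \<ominus>\<^bsub>F\<^esub> Q x) \<le> e * vnorm E x ^ n"
      by blast
  qed
  have diff_cpoly: "(\<lambda>x\<in>carrier E. s i x \<ominus>\<^bsub>F\<^esub> Q x) \<in> cpoly n E F" for i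
  proof -
    have "(\<lambda>x\<in>carrier E. s i x \<ominus>\<^bsub>F\<^esub> Q x) = (\<lambda>x\<in>carrier E. s i x \<oplus>\<^bsub>F\<^esub> (\<lambda>x\<in>carrier E. (- 1) \<odot>\<^bsub>F\<^esub> Q x) x)"
      using Qx by (intro restrict_ext) (simp add: F.diff_conv_smult)
    then show ?thesis
      using cpoly_add[OF summing_cpoly[OF s] cpoly_smult[OF Q]] by simp
  qed
  \<comment> \<open>\<open>Q\<close> is summing, being the difference of the summing polynomials \<open>s M\<close> and \<open>s M - Q\<close>.\<close>
  obtain M where M: "summing_bound n E F (\<lambda>x\<in>carrier E. s M x \<ominus>\<^bsub>F\<^esub> Q x) 1"
    using bound[OF zero_less_one] by blast
  have "(\<lambda>x\<in>carrier E. s M x \<oplus>\<^bsub>F\<^esub> (\<lambda>x\<in>carrier E. (- 1) \<odot>\<^bsub>F\<^esub> (\<lambda>x\<in>carrier E. s M x \<ominus>\<^bsub>F\<^esub> Q x) x) x) \<in> summing n E F"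
    by (intro summing_add(1)[OF s] summing_smult_le(1) summingI(1)[OF bE n diff_cpoly M]) simp
  also have "(\<lambda>x\<in>carrier E. s M x \<oplus>\<^bsub>F\<^esub> (\<lambda>x\<in>carrier E. (- 1) \<odot>\<^bsub>F\<^esub> (\<lambda>x\<in>carrier E. s M x \<ominus>\<^bsub>F\<^esub> Q x) x) x) = Q"
  proof (rule extensionalityI[OF _ cpoly_extensional[OF Q]])
    fix x
    assume x: "x \<in> carrier E"
    have "s M x \<oplus>\<^bsub>F\<^esub> (- 1) \<odot>\<^bsub>F\<^esub> (s M x \<ominus>\<^bsub>F\<^esub> Q x) = (s M x \<ominus>\<^bsub>F\<^esub> \<zero>\<^bsub>F\<^esub>) \<ominus>\<^bsub>F\<^esub> (s M x \<ominus>\<^bsub>F\<^esub> Q x)"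
      using sx[OF x] Qx[OF x] by (simp add: F.diff_conv_smult)
    also have "\<dots> = Q x"
      using sx[OF x, of M] Qx[OF x] F.diff_swap[of "s M x" "Q x"] F.diff_add_diff[of "Q x" "s M x" "\<zero>\<^bsub>F\<^esub>"]
        F.a_comm[of "s M x" "Q x \<ominus>\<^bsub>F\<^esub> s M x"] F.diff_conv_smult[of "s M x \<ominus>\<^bsub>F\<^esub> Q x" "s M x"]
      by simp
    finally show "(\<lambda>x\<in>carrier E. s M x \<oplus>\<^bsub>F\<^esub>
        (\<lambda>x\<in>carrier E. (- 1) \<odot>\<^bsub>F\<^esub> (\<lambda>x\<in>carrier E. s M x \<ominus>\<^bsub>F\<^esub> Q x) x) x) x = Q x"
      using x by simp
  qed simp
  finally have QS: "Q \<in> summing n E F" .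
  have "(\<lambda>i. summing_norm n E F (s i \<ominus>\<^bsub>summing_module\<^esub> Q)) \<longlonglongrightarrow> 0"
  proof (rule LIMSEQ_I)
    fix e :: real
    assume e: "0 < e"
    then obtain M where M: "\<And>i. i \<ge> M \<Longrightarrow> summing_bound n E F (\<lambda>x\<in>carrier E. s i x \<ominus>\<^bsub>F\<^esub> Q x) (e / 2)"
      using bound[of "e / 2"] by auto
    have "norm (summing_norm n E F (s i \<ominus>\<^bsub>summing_module\<^esub> Q) - 0) < e" if "i \<ge> M" for i
    proof -
      note * = summingI[OF bE n diff_cpoly M[OF that]]
      have "summing_norm n E F (\<lambda>x\<in>carrier E. s i x \<ominus>\<^bsub>F\<^esub> Q x) \<le> e / 2"
        "0 \<le> summing_norm n E F (\<lambda>x\<in>carrier E. s i x \<ominus>\<^bsub>F\<^esub> Q x)"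
        using * e summing_norm_nonneg by simp_all
      then show ?thesis
        unfolding summing_diff[OF s QS] using e by (simp add: abs_of_nonneg)
    qed
    then show "\<exists>M. \<forall>i\<ge>M. norm (summing_norm n E F (s i \<ominus>\<^bsub>summing_module\<^esub> Q) - 0) < e"
      by blast
  qed
  then show "\<exists>l\<in>carrier summing_module. (\<lambda>i. summing_norm n E F (s i \<ominus>\<^bsub>summing_module\<^esub> l)) \<longlonglongrightarrow> 0"
    using QS by auto
qed

lemma summing_p_banach: "p_banach q summing_module (summing_norm n E F)"
proof -
  have "p_norm_on q summing_module (summing_norm n E F)"
    unfolding p_norm_on_def
    using summing_norm_nonneg summing_norm_eq_zero summing_zero(2) summing_norm_smult summing_add(2)
    by (auto simp: cpoly_module_def)
  then show ?thesis
    using linear_space.module_V[OF linear_space_summing] summing_complete by (simp add: p_banach_def)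
qed

end

section \<open>The hyper-ideal property\<close>

lemma scalarly_dominatedD:
  assumes "scalarly_dominated Y X" "x \<in> {..<k} \<rightarrow> carrier scalar_space"
  shows "snd (Y scalar_space) (fin_seq scalar_space k x) \<le> snd (X scalar_space) (fin_seq scalar_space k x)"
  using assms unfolding scalarly_dominated_def by blast

context summing_component
begin

text \<open>The map factors through the line spanned by \<open>y\<close>, so the inequality for operators in \<open>Y\<close>
  reduces the claim to scalar sequences, and there \<open>Y\<close> is dominated by \<open>X\<close>.\<close>

lemma summing_scalar_times_vector:
  assumes dom: "scalarly_dominated Y X" and R: "R \<in> cpoly n E K" and y: "y \<in> carrier F"
  shows "(\<lambda>x\<in>carrier E. projl (R x) \<odot>\<^bsub>F\<^esub> y) \<in> summing n E F"
proof -
  let ?P = "\<lambda>x\<in>carrier E. line_map F y (R x)"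
  have line: "line_map F y \<in> cpoly 1 K F"
    by (rule F.line_map_cpoly[OF y])
  interpret EK: normed_pair E K
    using bE by (rule X.normed_pair_scalar)
  interpret KF: normed_pair K F
    using bF by (intro normed_pair.intro normed_spaceI banach_space_scalar_space)
  have P: "?P \<in> cpoly n E F"
    using cpoly_compose[OF line R] by simp
  have nonneg: "0 \<le> poly_norm K F (line_map F y)" "0 \<le> poly_norm E K R"
    using KF.poly_norm_nonneg[OF line order_refl] EK.poly_norm_nonneg[OF R n] by auto
  have "summing_bound n E F ?P (poly_norm K F (line_map F y) * poly_norm E K R)"
    unfolding summing_bound_def
  proof (intro allI ballI)
    fix k x
    assume x: "x \<in> {..<k::nat} \<rightarrow> carrier E"
    note Rx = cpoly_image[OF R x]
    have "fin_seq F k (\<lambda>j. ?P (x j)) = fin_seq F k (\<lambda>j. line_map F y (R (x j)))"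
      using x by (intro fin_seq_cong) auto
    then have "snd (Y F) (fin_seq F k (\<lambda>j. ?P (x j))) \<le>
        poly_norm K F (line_map F y) * snd (Y K) (fin_seq K k (\<lambda>j. R (x j)))"
      using Y.fin_seq_linear_image[OF banach_space_scalar_space bF line Rx] by simp
    also have "\<dots> \<le> poly_norm K F (line_map F y) * snd (X K) (fin_seq K k (\<lambda>j. R (x j)))"
      by (intro mult_left_mono scalarly_dominatedD[OF dom Rx] nonneg)
    also have "\<dots> \<le> poly_norm K F (line_map F y) * (poly_norm E K R * weak_poly_norm X n E k x)"
      by (intro mult_left_mono X.weak_norm_scalar_poly[OF bE n x R] nonneg)
    finally show "snd (Y F) (fin_seq F k (\<lambda>j. ?P (x j))) \<le>
        poly_norm K F (line_map F y) * poly_norm E K R * weak_poly_norm X n E k x"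
      by (simp add: mult.assoc)
  qed
  from summingI(1)[OF bE n P this] have "?P \<in> summing n E F"
    using nonneg by simp
  also have "?P = (\<lambda>x\<in>carrier E. projl (R x) \<odot>\<^bsub>F\<^esub> y)"
    using cpoly_closed[OF R] by (intro restrict_ext) (simp add: line_map_def)
  finally show ?thesis .
qed

lemma summing_finite_type:
  fixes k :: nat
  assumes dom: "scalarly_dominated Y X"
    and \<phi>: "\<And>i. i < k \<Longrightarrow> \<phi> i \<in> cpoly 1 E K" and y: "\<And>i. i < k \<Longrightarrow> y i \<in> carrier F"
  shows "(\<lambda>x\<in>carrier E. \<Oplus>\<^bsub>F\<^esub>i\<in>{..<k}. (projl (\<phi> i x)) ^ n \<odot>\<^bsub>F\<^esub> y i) \<in> summing n E F"
  using \<phi> y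
proof (induction k)
  case 0
  show ?case
    using summing_zero(1) by (simp only: lessThan_0 F.finsum_empty)
next
  case (Suc k)
  let ?S = "\<lambda>x\<in>carrier E. \<Oplus>\<^bsub>F\<^esub>i\<in>{..<k}. (projl (\<phi> i x)) ^ n \<odot>\<^bsub>F\<^esub> y i"
  let ?R = "\<lambda>x\<in>carrier E. scalar_power n (\<phi> k x)"
  have \<phi>k: "\<phi> k \<in> cpoly 1 E K" and yk: "y k \<in> carrier F"
    using Suc.prems by simp_all
  have R: "?R \<in> cpoly n E K"
    using cpoly_compose[OF scalar_power_cpoly \<phi>k, of n] by simp
  have "?S \<in> summing n E F"
    using Suc.prems by (intro Suc.IH) simp_all
  from summing_add(1)[OF summing_scalar_times_vector[OF dom R yk] this]
  have "(\<lambda>x\<in>carrier E. (\<lambda>x\<in>carrier E. projl (?R x) \<odot>\<^bsub>F\<^esub> y k) x \<oplus>\<^bsub>F\<^esub> ?S x) \<in> summing n E F" .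
  also have "(\<lambda>x\<in>carrier E. (\<lambda>x\<in>carrier E. projl (?R x) \<odot>\<^bsub>F\<^esub> y k) x \<oplus>\<^bsub>F\<^esub> ?S x) =
      (\<lambda>x\<in>carrier E. \<Oplus>\<^bsub>F\<^esub>i\<in>{..<Suc k}. (projl (\<phi> i x)) ^ n \<odot>\<^bsub>F\<^esub> y i)"
  proof (rule restrict_ext)
    fix x
    assume x: "x \<in> carrier E"
    have "projl (?R x) = projl (\<phi> k x) ^ n"
      using x cpoly_closed[OF \<phi>k x] by (simp add: scalar_power_def)
    then show "(\<lambda>x\<in>carrier E. projl (?R x) \<odot>\<^bsub>F\<^esub> y k) x \<oplus>\<^bsub>F\<^esub> ?S x =
        (\<Oplus>\<^bsub>F\<^esub>i\<in>{..<Suc k}. (projl (\<phi> i x)) ^ n \<odot>\<^bsub>F\<^esub> y i)"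
      using x Suc.prems by (simp add: lessThan_Suc Pi_iff)
  qed
  finally show ?case .
qed

end

context functor_pair
begin

text \<open>The upper bound holds because the power map is itself in the unit ball of scalar polynomials;
  the lower one comes from evaluating at \<open>1\<close>.\<close>

lemma summing_norm_scalar_power:
  assumes dom: "scalarly_dominated Y X" and n: "1 \<le> n"
  shows "summing_norm n K K (scalar_power n) = 1"
proof -
  note bK = banach_space_scalar_space
  note pow = scalar_power_cpoly[of n]
  have "summing_bound n K K (scalar_power n) 1"
    unfolding summing_bound_def
  proof (intro allI ballI)
    fix k x
    assume x: "x \<in> {..<k::nat} \<rightarrow> carrier K"
    have "snd (Y K) (fin_seq K k (\<lambda>j. scalar_power n (x j))) \<le> snd (X K) (fin_seq K k (\<lambda>j. scalar_power n (x j)))"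
      by (rule scalarly_dominatedD[OF dom cpoly_image[OF pow x]])
    also have "\<dots> \<le> weak_poly_norm X n K k x"
      by (rule X.weak_norm_upper[OF bK n x pow poly_norm_scalar_power_le])
    finally show "snd (Y K) (fin_seq K k (\<lambda>j. scalar_power n (x j))) \<le> 1 * weak_poly_norm X n K k x"
      by simp
  qed
  note * = summingI[OF bK n pow this zero_le_one]
  have "vnorm K (scalar_power n (Inl 1)) \<le> summing_norm n K K (scalar_power n) * vnorm K (Inl 1) ^ n"
    by (rule summing_bound_pointwise[OF bK bK n summing_bound_norm[OF bK n *(1)] summing_norm_nonneg[OF *(1)]])
      (simp_all add: scalar_power_def)
  then have "1 \<le> summing_norm n K K (scalar_power n)"
    by (simp add: scalar_power_def)
  then show ?thesis
    using *(2) by simp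
qed

text \<open>The left factor is absorbed by \<open>fin_seq_linear_image\<close>, the right one by
  \<open>weak_norm_compose\<close>.\<close>

lemma summing_ideal:
  assumes E: "banach_space E" and F: "banach_space F" and G: "banach_space G" and H: "banach_space H"
    and n: "1 \<le> n" and m: "1 \<le> m"
    and P: "P \<in> summing n E F" and R: "R \<in> cpoly m G E" and t: "t \<in> cpoly 1 F H"
  shows "(\<lambda>x\<in>carrier G. t (P (R x))) \<in> summing (m * n) G H"
    and "summing_norm (m * n) G H (\<lambda>x\<in>carrier G. t (P (R x)))
      \<le> poly_norm F H t * summing_norm n E F P * poly_norm G E R ^ n"
proof -
  let ?T = "\<lambda>x\<in>carrier G. t (P (R x))"
  interpret FH: normed_pair F H
    using F H by (intro normed_pair.intro normed_spaceI)
  interpret GE: normed_pair G E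
    using G E by (intro normed_pair.intro normed_spaceI)
  have mn: "1 \<le> m * n"
    using m n by simp
  have nonneg: "0 \<le> poly_norm F H t" "0 \<le> summing_norm n E F P" "0 \<le> poly_norm G E R"
    using FH.poly_norm_nonneg[OF t order_refl] summing_norm_nonneg[OF P] GE.poly_norm_nonneg[OF R m] by auto
  have "(\<lambda>x\<in>carrier G. t ((\<lambda>x\<in>carrier G. P (R x)) x)) \<in> cpoly (m * n * 1) G H"
    by (rule cpoly_compose[OF t cpoly_compose[OF summing_cpoly[OF P] R]])
  also have "(\<lambda>x\<in>carrier G. t ((\<lambda>x\<in>carrier G. P (R x)) x)) = ?T"
    by (intro restrict_ext) simp
  finally have T: "?T \<in> cpoly (m * n) G H"
    by (simp only: mult_1_right)
  have "summing_bound (m * n) G H ?T (poly_norm F H t * summing_norm n E F P * poly_norm G E R ^ n)"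
    unfolding summing_bound_def
  proof (intro allI ballI)
    fix k x
    assume x: "x \<in> {..<k::nat} \<rightarrow> carrier G"
    note Rx = cpoly_image[OF R x]
    note PRx = cpoly_image[OF summing_cpoly[OF P] Rx]
    have "fin_seq H k (\<lambda>j. ?T (x j)) = fin_seq H k (\<lambda>j. t (P (R (x j))))"
      using x by (intro fin_seq_cong) auto
    then have "snd (Y H) (fin_seq H k (\<lambda>j. ?T (x j))) \<le>
        poly_norm F H t * snd (Y F) (fin_seq F k (\<lambda>j. P (R (x j))))"
      using Y.fin_seq_linear_image[OF F H t PRx] by simp
    also have "\<dots> \<le> poly_norm F H t * (summing_norm n E F P * weak_poly_norm X n E k (\<lambda>j. R (x j)))"
      by (intro mult_left_mono summing_boundD[OF summing_bound_norm[OF E n P] Rx] nonneg)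
    also have "\<dots> \<le> poly_norm F H t * (summing_norm n E F P *
        (poly_norm G E R ^ n * weak_poly_norm X (m * n) G k x))"
      by (intro mult_left_mono X.weak_norm_compose[OF E G n m R x] nonneg)
    finally show "snd (Y H) (fin_seq H k (\<lambda>j. ?T (x j))) \<le>
        poly_norm F H t * summing_norm n E F P * poly_norm G E R ^ n * weak_poly_norm X (m * n) G k x"
      by (simp add: mult.assoc)
  qed
  note * = summingI[OF G mn T this]
  show "?T \<in> summing (m * n) G H"
    "summing_norm (m * n) G H ?T \<le> poly_norm F H t * summing_norm n E F P * poly_norm G E R ^ n"
    by (intro * mult_nonneg_nonneg zero_le_power nonneg)+
qed

end

theorem theorem5p2:
  fixes X Y :: "('k::{real_normed_field, banach}, 'u) seq_corr"
    and p q :: real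
  assumes "0 < p" "p \<le> 1" "0 < q" "q \<le> 1"
    and "seq_functor p X"
    and "seq_functor q Y"
    and "scalarly_dominated Y X"
  shows "banach_hyper_ideal q (summing_polys X Y)"
proof -
  interpret functor_pair X Y p q
    using assms by (intro functor_pair.intro sequence_functor.intro)
  have component: "summing_component X Y p q n E F" if "1 \<le> n" "banach_space E" "banach_space F"
    for n and E F :: "('k, 'k + 'u) nspace"
    using that by (intro summing_component.intro summing_component_axioms.intro functor_pair_axioms)
  show ?thesis
    unfolding banach_hyper_ideal_def
  proof (intro conjI allI impI ballI)
    fix n :: nat and E F :: "('k, 'k + 'u) nspace"
    assume "1 \<le> n" "banach_space E" "banach_space F"
    then interpret summing_component X Y p q n E F
      by (rule component)
    show "submodule (summing n E F) scalar_ring (cpoly_module n E F)"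
      by (rule submodule_summing)
    show "p_banach q ((cpoly_module n E F)\<lparr>carrier := summing n E F\<rparr>) (summing_norm n E F)"
      by (rule summing_p_banach)
    show "(\<lambda>x\<in>carrier E. \<Oplus>\<^bsub>F\<^esub>i\<in>{..<k}. (projl (\<phi> i x)) ^ n \<odot>\<^bsub>F\<^esub> y i) \<in> summing n E F"
      if "\<forall>i<k. \<phi> i \<in> cpoly 1 E K \<and> y i \<in> carrier F" for k :: nat and \<phi> y
      using that by (intro summing_finite_type[OF assms(7)]) simp_all
  next
    fix n :: nat
    assume "1 \<le> n"
    then show "summing_norm n K K (\<lambda>x\<in>carrier K. Inl (projl x ^ n)) = 1"
      using summing_norm_scalar_power[OF assms(7)] by (simp add: scalar_power_def)
  next
    fix n m :: nat and E F G H :: "('k, 'k + 'u) nspace" and P R t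
    assume "1 \<le> n" "1 \<le> m" "banach_space E" "banach_space F" "banach_space G" "banach_space H"
      "P \<in> summing n E F" "R \<in> cpoly m G E" "t \<in> cpoly 1 F H"
    note * = summing_ideal[OF this(3-6,1,2,7-9)]
    show "(\<lambda>x\<in>carrier G. t (P (R x))) \<in> summing (m * n) G H"
      by (rule *(1))
    show "summing_norm (m * n) G H (\<lambda>x\<in>carrier G. t (P (R x)))
        \<le> poly_norm F H t * summing_norm n E F P * poly_norm G E R ^ n"
      by (rule *(2))
  qed
qed

end
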